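(* Let $0<\beta\le1$, $\lambda>0$, and let $Q_\beta^f(t)=N_\beta(D_f(t))$, $t\ge 0$, where $\{N_\beta(t)\}_{t\ge0}$ is the fractional Poisson process with parameters $\beta,\lambda$ and $\{D_f(t)\}_{t\ge0}$ is a subordinator independent of it with $\mathbb{E}[D_f^r(t)]<\infty$ for all $r>0$. Suppose that, as $t\to\infty$, $\mathbb{E}[D_f^\beta(t)]\sim k_1t^\rho$ and $\mathbb{E}[D_f^{2\beta}(t)]\sim k_2t^{2\rho}$ for some $0<\rho<1$ and positive constants $k_1,k_2$ with $k_2\ge k_1^2$. Then $\{Q_\beta^f(t)\}_{t\ge0}$ has the long-range dependence property.
   Context: Notation: $D_f^r(t)=(D_f(t))^r$; for positive functions $g,h$, $g(t)\sim h(t)$ as $t\to\infty$ means $\lim_{t\to\infty}g(t)/h(t)=1$. Long-range dependence (LRD): a stochastic process $\{X(t)\}_{t\ge0}$ has the LRD property if there is $d\in(0,1)$ such that for fixed $s>0$ its correlation function satisfies $\lim_{t\to\infty}\mathrm{Corr}[X(s),X(t)]/t^{-d}=c(s)$ for some $c(s)>0$. Subordinator: $\{D_f(t)\}_{t\ge 0}$ is a nondecreasing Lévy process with $D_f(0)=0$ a.s. and $\mathbb{E}[e^{-sD_f(t)}]=e^{-tf(s)}$, $s>0$, where $f$ is the Bernstein function $f(s)=bs+\int_0^\infty(1-e^{-sx})\,\nu(dx)$, with $b\ge0$ and $\nu$ a non-negative Lévy measure on $(0,\infty)$ satisfying $\int_0^\infty (x\wedge1)\,\nu(dx)<\infty$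 and $\nu(0,\infty)=\infty$ (so sample paths are a.s. strictly increasing). Fractional Poisson process (FPP): for $0<\beta<1$, let $\{D_\beta(t)\}$ be the $\beta$-stable subordinator, $\mathbb{E}[e^{-sD_\beta(t)}]=e^{-ts^\beta}$, and $E_\beta(t)=\inf\{r\ge0: D_\beta(r)>t\}$ the inverse $\beta$-stable subordinator. The FPP is $N_\beta(t)=N_\beta(t,\lambda)=N(E_\beta(t),\lambda)$, where $\{N(t,\lambda)\}$ is a Poisson process of rate $\lambda>0$ independent of $E_\beta$. For $\beta=1$ the FPP is the Poisson process of rate $\lambda$. *)

theory Defs
  imports "HOL-Probability.Probability" "HOL-Library.Landau_Symbols"
begin

text \<open>
  A real-valued process with time set \<open>[0,\<infinity>)\<close> is a function \<open>X :: real \<Rightarrow> 'a \<Rightarrow> real\<close> of which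
  only the values at times \<open>t \<ge> 0\<close> matter. Path properties are only required almost surely.
\<close>

context prob_space
begin

text \<open>
  Independence of two whole processes, i.e. of the path-valued random variables, on the
  product sigma-algebra of \<open>\<real>\<^bsup>[0,\<infinity>)\<^esup>\<close>; by definition of \<^const>\<open>indep_var\<close> this includes that
  every \<open>X t\<close> and \<open>Y t\<close> with \<open>t \<ge> 0\<close> is a random variable.
\<close>

definition indep_processes :: "(real \<Rightarrow> 'a \<Rightarrow> real) \<Rightarrow> (real \<Rightarrow> 'a \<Rightarrow> real) \<Rightarrow> bool" where
  "indep_processes X Y \<longleftrightarrow>
     indep_var (PiM {0..} (\<lambda>_. borel)) (\<lambda>\<omega>. \<lambda>t\<in>{0..}. X t \<omega>)
               (PiM {0..} (\<lambda>_. borel)) (\<lambda>\<omega>. \<lambda>t\<in>{0..}. Y t \<omega>)"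

text \<open>
  Stochastic continuity is not listed, since it follows from right-continuity of the paths
  and stationarity of the increments.
\<close>

definition levy_process :: "(real \<Rightarrow> 'a \<Rightarrow> real) \<Rightarrow> bool" where
  "levy_process X \<longleftrightarrow>
     (\<forall>t\<ge>0. random_variable borel (X t)) \<and>
     (AE \<omega> in M. X 0 \<omega> = 0) \<and>
     (\<forall>(n::nat) (u :: nat \<Rightarrow> real). 0 \<le> u 0 \<and> (\<forall>i<n. u i \<le> u (Suc i)) \<longrightarrow>
        indep_vars (\<lambda>_. borel) (\<lambda>i \<omega>. X (u (Suc i)) \<omega> - X (u i) \<omega>) {..<n}) \<and>
     (\<forall>s\<ge>0. \<forall>t\<ge>0. distr M borel (\<lambda>\<omega>. X (s + t) \<omega> - X s \<omega>) = distr M borel (X t)) \<and>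
     (AE \<omega> in M. \<forall>t\<ge>0. ((\<lambda>u. X u \<omega>) \<longlongrightarrow> X t \<omega>) (at_right t)) \<and>
     (AE \<omega> in M. \<forall>t>0. \<exists>l. ((\<lambda>u. X u \<omega>) \<longlongrightarrow> l) (at_left t))"

text \<open>For \<open>t = 0\<close> the value is fixed by \<^const>\<open>levy_process\<close>; \<^const>\<open>poisson_pmf\<close> needs a positive rate.\<close>

definition poisson_process :: "real \<Rightarrow> (real \<Rightarrow> 'a \<Rightarrow> real) \<Rightarrow> bool" where
  "poisson_process lam N \<longleftrightarrow>
     levy_process N \<and>
     (\<forall>t>0. distr M borel (N t) = distr (measure_pmf (poisson_pmf (lam * t))) borel real)"

end

definition levy_measure :: "real measure \<Rightarrow> bool" where
  "levy_measure \<nu> \<longleftrightarrow>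
     sets \<nu> = sets borel \<and> emeasure \<nu> {..0} = 0 \<and>
     (\<integral>\<^sup>+x\<in>{0<..}. ennreal (min x 1) \<partial>\<nu>) < \<infinity> \<and> emeasure \<nu> {0<..} = \<infinity>"

definition bernstein_function :: "(real \<Rightarrow> real) \<Rightarrow> bool" where
  "bernstein_function f \<longleftrightarrow>
     (\<exists>b \<nu>. b \<ge> 0 \<and> levy_measure \<nu> \<and>
        (\<forall>s>0. f s = b * s + (LINT x:{0<..}|\<nu>. 1 - exp (- (s * x)))))"

context prob_space
begin

definition subordinator :: "(real \<Rightarrow> real) \<Rightarrow> (real \<Rightarrow> 'a \<Rightarrow> real) \<Rightarrow> bool" where
  "subordinator f D \<longleftrightarrow>
     bernstein_function f \<and> levy_process D \<and>
     (AE \<omega> in M. \<forall>s t. 0 \<le> s \<and> s \<le> t \<longrightarrow> D s \<omega> \<le> D t \<omega>) \<and>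
     (\<forall>t\<ge>0. \<forall>s>0. expectation (\<lambda>\<omega>. exp (- (s * D t \<omega>))) = exp (- (t * f s)))"

end

definition inverse_process :: "(real \<Rightarrow> 'a \<Rightarrow> real) \<Rightarrow> real \<Rightarrow> 'a \<Rightarrow> real" where
  "inverse_process D t \<omega> = Inf {r. 0 \<le> r \<and> D r \<omega> > t}"

context prob_space
begin

text \<open>
  The time change is required up to indistinguishability, because on the null event where the
  paths of \<open>S\<close> stay bounded the infimum over the empty set is not meaningful.
\<close>

definition fractional_poisson_process :: "real \<Rightarrow> real \<Rightarrow> (real \<Rightarrow> 'a \<Rightarrow> real) \<Rightarrow> bool" where
  "fractional_poisson_process \<beta> lam X \<longleftrightarrow>
     (if \<beta> = 1 then poisson_process lam X
      else (\<forall>t\<ge>0. random_variable borel (X t)) \<and>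
        (\<exists>N S. poisson_process lam N \<and> subordinator (\<lambda>s. s powr \<beta>) S \<and>
           indep_processes N (inverse_process S) \<and>
           (AE \<omega> in M. \<forall>t\<ge>0. X t \<omega> = N (inverse_process S t \<omega>) \<omega>)))"

definition covariance :: "('a \<Rightarrow> real) \<Rightarrow> ('a \<Rightarrow> real) \<Rightarrow> real" where
  "covariance U V = expectation (\<lambda>\<omega>. (U \<omega> - expectation U) * (V \<omega> - expectation V))"

definition correlation :: "('a \<Rightarrow> real) \<Rightarrow> ('a \<Rightarrow> real) \<Rightarrow> real" where
  "correlation U V = covariance U V / (sqrt (variance U) * sqrt (variance V))"

text \<open>
  The exponent \<open>d\<close> does not depend on \<open>s\<close>. If \<open>X\<close> consists of random variables, then \<open>c s > 0\<close>
  forces \<open>X s\<close> and eventually \<open>X t\<close> to be square integrable and not almost surely constant: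
  otherwise the Bochner integral, or division by zero, makes the correlation \<open>0\<close>.
\<close>

definition long_range_dependent :: "(real \<Rightarrow> 'a \<Rightarrow> real) \<Rightarrow> bool" where
  "long_range_dependent X \<longleftrightarrow>
     (\<exists>d c. 0 < d \<and> d < 1 \<and>
        (\<forall>s>0. c s > 0 \<and>
           ((\<lambda>t. correlation (X s) (X t) / t powr (- d)) \<longlongrightarrow> c s) at_top))"

end

end

theory Submission
  imports Defs
begin

text \<open>
  For $\beta < 1$ write the fractional Poisson process as $N \circ E$ with $E$ the inverse of the stable
  subordinator $S$. Since $E(t)$ is the time that $S$ spends in $[0,t]$, its first two moments are
  integrals against the potential measure of $S$, which is identified by its Laplace transform
  $s^{-\beta}$. Conditioning on $E$ and then on $D$ gives, with $q = \lambda / \Gamma(1+\beta)$,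
  \[ \mathrm{Cov}(Q(s), Q(t)) = q\,E D(s)^\beta + q^2 \bigl( k\,E D(s)^{2\beta} + E H(D(s), D(t))
     - E D(s)^\beta\, E D(t)^\beta \bigr), \]
  where $x^\beta (y-x)^\beta \le H(x,y) \le x^\beta y^\beta$ for $x \le y$ and $H(x,x) = k x^{2\beta}$
  with $k \ge 1/(1+\beta) > 1/2$. As $t \to \infty$ the last difference vanishes, because
  $D(t)^\beta - (D(t) - D(s))^\beta \to 0$ and increments are independent and stationary; hence the
  covariance has a positive limit. The variance is asymptotic to $q^2 (2 k k_2 - k_1^2)\,t^{2\rho}$, with
  positive constant since $2k > 1$ and $k_2 \ge k_1^2$, so that the correlation decays like $t^{-\rho}$.
  The case $\beta = 1$ is void: $E D(t)$ is linear in $t$.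
\<close>

subsection \<open>Random time changes\<close>

text \<open>Independence is given on the product sigma-algebra of path space, where evaluation at a
  random time is not jointly measurable. Conditioning on a clock therefore goes through a version of
  evaluation built from right limits. As X is itself run by the clock D, right-continuity has to be
  passed on from N to X. The moments of N, E and Q are computed as nonnegative integrals: Tonelli
  then applies at once, and integrability of Q is read off the finite result. H is a normalised
  convolution of the potential measure of S with its distribution function U(z) = z^\<beta> /
  Gamma(1+\<beta>): H(x,y) is Gamma(1+\<beta>)^2 times the integral of U(y-z) dU(z) over [0,x]. In
  closed form k would be Gamma(1+\<beta>)^2 / Gamma(1+2\<beta>); the proof works instead with k >
  1/2 and two-sided bounds on H, which squeeze the covariance between expressions in D alone. The
  strictness of k > 1/2 matters when k2 = k1^2, where k = 1/2 would make the leading coefficient of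
  the variance vanish.\<close>

definition grid :: "nat \<Rightarrow> real \<Rightarrow> real" where
  "grid n \<tau> = (real (nat \<lfloor>real (Suc n) * \<tau>\<rfloor>) + 1) / real (Suc n)"

lemma grid_bounds:
  assumes "\<tau> \<ge> 0"
  shows "\<tau> < grid n \<tau>" "grid n \<tau> \<le> \<tau> + 1 / real (Suc n)"
proof -
  define m where "m = real (Suc n)"
  have m: "m > 0" by (simp add: m_def)
  have *: "real (nat \<lfloor>m * \<tau>\<rfloor>) = of_int \<lfloor>m * \<tau>\<rfloor>"
    using assms m by simp
  have **: "grid n \<tau> = (of_int \<lfloor>m * \<tau>\<rfloor> + 1) / m"
    by (simp only: grid_def * flip: m_def)
  have "m * \<tau> < of_int \<lfloor>m * \<tau>\<rfloor> + 1" "of_int \<lfloor>m * \<tau>\<rfloor> \<le> m * \<tau>"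
    by linarith+
  then show "\<tau> < grid n \<tau>" "grid n \<tau> \<le> \<tau> + 1 / real (Suc n)"
    unfolding ** m_def[symmetric] using m by (simp_all add: field_simps)
qed

text \<open>The \<open>+ 1\<close> in \<open>grid\<close> keeps the points strictly to the right of
  \<tau>, even when \<tau> is a multiple of the mesh, so the sequence runs along
  \<open>at_right \<tau>\<close>, the filter of the continuity hypotheses.\<close>

lemma filterlim_grid:
  assumes "\<tau> \<ge> 0"
  shows "filterlim (\<lambda>n. grid n \<tau>) (at_right \<tau>) sequentially"
proof -
  have "(\<lambda>n. \<tau> + 1 / real (Suc n)) \<longlonglongrightarrow> \<tau> + 0"
    by (intro tendsto_add tendsto_const LIMSEQ_Suc lim_1_over_n)
  then have lim: "(\<lambda>n. \<tau> + 1 / real (Suc n)) \<longlonglongrightarrow> \<tau>"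
    by simp
  have "(\<lambda>n. grid n \<tau>) \<longlonglongrightarrow> \<tau>"
    by (rule tendsto_sandwich[OF always_eventually always_eventually tendsto_const lim])
       (use grid_bounds[OF assms] less_imp_le in blast)+
  moreover have "grid n \<tau> \<in> {\<tau><..}" "grid n \<tau> \<noteq> \<tau>" for n
    using grid_bounds(1)[OF assms, of n] by simp_all
  ultimately show ?thesis
    unfolding filterlim_at by (intro conjI always_eventually allI) auto
qed

text \<open>
  Evaluation of a right-continuous path at a time, written as a limit over countable grids: unlike
  plain evaluation it is jointly measurable in the path and the time.
\<close>

definition right_eval :: "(real \<Rightarrow> real) \<Rightarrow> real \<Rightarrow> real" where
  "right_eval y \<tau> = lim (\<lambda>n. y (grid n \<tau>))"

lemma right_eval_eq:
  assumes "\<tau> \<ge> 0" "(y \<longlongrightarrow> y \<tau>) (at_right \<tau>)"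
  shows "right_eval y \<tau> = y \<tau>"
  unfolding right_eval_def using filterlim_compose[OF assms(2) filterlim_grid[OF assms(1)]] by (rule limI)

text \<open>For fixed n the grid value depends on \<open>g x\<close> only through a natural number,
  so the composition is glued from countably many measurable functions; the limit in n preserves
  measurability. All grid values are positive, which is why F is only evaluated at t > 0.\<close>

lemma borel_measurable_right_eval:
  assumes F: "\<And>t. t > 0 \<Longrightarrow> F t \<in> borel_measurable K" and g[measurable]: "g \<in> borel_measurable K"
  shows "(\<lambda>x. right_eval (\<lambda>t. F t x) (g x)) \<in> borel_measurable K"
  unfolding right_eval_def
proof (rule borel_measurable_lim_metric)
  fix n
  have "(\<lambda>x. F ((real (nat \<lfloor>real (Suc n) * g x\<rfloor>) + 1) / real (Suc n)) x) \<in> borel_measurable K"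
    by (rule measurable_compose_countable[where f="\<lambda>i. F ((real i + 1) / real (Suc n))"])
       (auto intro!: F)
  then show "(\<lambda>x. F (grid n (g x)) x) \<in> borel_measurable K"
    by (simp add: grid_def)
qed

text \<open>Independence makes the joint law a product, and Tonelli then freezes Y while X is
  averaged over a second copy of the sample space.\<close>

lemma (in prob_space) indep_var_nn_integral:
  assumes "indep_var S X T Y" and h: "h \<in> borel_measurable (S \<Otimes>\<^sub>M T)"
  shows "(\<integral>\<^sup>+\<omega>. h (X \<omega>, Y \<omega>) \<partial>M) = (\<integral>\<^sup>+\<omega>. \<integral>\<^sup>+\<omega>'. h (X \<omega>', Y \<omega>) \<partial>M \<partial>M)"
proof -
  have X[measurable]: "X \<in> M \<rightarrow>\<^sub>M S" and Y[measurable]: "Y \<in> M \<rightarrow>\<^sub>M T"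
    and eq: "distr M S X \<Otimes>\<^sub>M distr M T Y = distr M (S \<Otimes>\<^sub>M T) (\<lambda>x. (X x, Y x))"
    using assms(1) by (auto simp: indep_var_distribution_eq)
  note h[measurable]
  interpret X: prob_space "distr M S X" by (rule prob_space_distr) simp
  interpret Y: prob_space "distr M T Y" by (rule prob_space_distr) simp
  interpret XY: pair_sigma_finite "distr M S X" "distr M T Y" ..
  have hm: "h \<in> borel_measurable (distr M S X \<Otimes>\<^sub>M distr M T Y)"
    by simp
  have "(\<integral>\<^sup>+\<omega>. h (X \<omega>, Y \<omega>) \<partial>M) = (\<integral>\<^sup>+z. h z \<partial>distr M (S \<Otimes>\<^sub>M T) (\<lambda>x. (X x, Y x)))"
    by (simp add: nn_integral_distr)
  also have "\<dots> = (\<integral>\<^sup>+y. \<integral>\<^sup>+x. h (x, y) \<partial>distr M S X \<partial>distr M T Y)"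
    unfolding eq[symmetric] by (rule XY.nn_integral_snd[symmetric, OF hm])
  also have "\<dots> = (\<integral>\<^sup>+y. \<integral>\<^sup>+\<omega>'. h (X \<omega>', y) \<partial>M \<partial>distr M T Y)"
    by (intro nn_integral_cong nn_integral_distr) auto
  also have "\<dots> = (\<integral>\<^sup>+\<omega>. \<integral>\<^sup>+\<omega>'. h (X \<omega>', Y \<omega>) \<partial>M \<partial>M)"
    by (rule nn_integral_distr) auto
  finally show ?thesis .
qed

text \<open>Conditioning on the clock T. Replacing evaluation by \<open>right_eval\<close> turns the
  integrand into a measurable function of the two paths and, by right-continuity, changes it only on
  a null set. It is applied twice: to N run by the inverse subordinator, and to X run by D.\<close>

lemma (in prob_space) nn_integral_time_change:
  assumes ind: "indep_processes Y T"
    and rc: "AE \<omega> in M. \<forall>t\<ge>0. ((\<lambda>u. Y u \<omega>) \<longlongrightarrow> Y t \<omega>) (at_right t)"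
    and T: "AE \<omega> in M. \<forall>t\<ge>0. T t \<omega> \<ge> 0"
    and h[measurable]: "case_prod h \<in> borel_measurable (borel \<Otimes>\<^sub>M borel)"
    and st: "s \<ge> 0" "t \<ge> 0"
  shows "(\<integral>\<^sup>+\<omega>. h (Y (T s \<omega>) \<omega>) (Y (T t \<omega>) \<omega>) \<partial>M)
       = (\<integral>\<^sup>+\<omega>. \<integral>\<^sup>+\<omega>'. h (Y (T s \<omega>) \<omega>') (Y (T t \<omega>) \<omega>') \<partial>M \<partial>M)"
proof -
  define P where "P = PiM {0::real..} (\<lambda>_. borel :: real measure)"
  define y \<tau> where "y \<omega> = (\<lambda>t\<in>{0..}. Y t \<omega>)" and "\<tau> \<omega> = (\<lambda>t\<in>{0..}. T t \<omega>)" for \<omega>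
  have iv: "indep_var P y P \<tau>"
    using ind by (simp add: indep_processes_def P_def y_def[abs_def] \<tau>_def[abs_def])
  have comp[measurable]: "(\<lambda>y. y a) \<in> borel_measurable P" if "a \<ge> 0" for a
    unfolding P_def using that by (intro measurable_component_singleton) auto
  have ev[measurable]: "(\<lambda>z. right_eval (fst z) (snd z a)) \<in> borel_measurable (P \<Otimes>\<^sub>M P)" if "a \<ge> 0" for a
  proof -
    have 1: "(\<lambda>z. fst z b) \<in> borel_measurable (P \<Otimes>\<^sub>M P)" if "b > 0" for b
      by (rule measurable_compose[OF measurable_fst comp]) (use that in simp)
    have 2: "(\<lambda>z. snd z a) \<in> borel_measurable (P \<Otimes>\<^sub>M P)"
      by (rule measurable_compose[OF measurable_snd comp]) (use that in simp)
    from borel_measurable_right_eval[OF 1 2] show ?thesis by simp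
  qed
  have eval: "right_eval (y \<omega>) a = Y a \<omega>"
    if "\<forall>t\<ge>0. ((\<lambda>u. Y u \<omega>) \<longlongrightarrow> Y t \<omega>) (at_right t)" "a \<ge> 0" for \<omega> a
  proof -
    have "\<forall>\<^sub>F u in at_right a. Y u \<omega> = y \<omega> u"
      using that(2) by (auto simp: eventually_at_right_field y_def intro!: exI[of _ "a + 1"])
    with that have "(y \<omega> \<longlongrightarrow> Y a \<omega>) (at_right a)"
      using tendsto_cong[of "\<lambda>u. Y u \<omega>" "y \<omega>" "at_right a" "Y a \<omega>"] by blast
    then show ?thesis using right_eval_eq[of a "y \<omega>"] that(2) by (simp add: y_def)
  qed
  define H where "H z = h (right_eval (fst z) (snd z s)) (right_eval (fst z) (snd z t))"
    for z :: "(real \<Rightarrow> real) \<times> (real \<Rightarrow> real)"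
  have H: "H \<in> borel_measurable (P \<Otimes>\<^sub>M P)"
    unfolding H_def using st by measurable
  have "(\<integral>\<^sup>+\<omega>. h (Y (T s \<omega>) \<omega>) (Y (T t \<omega>) \<omega>) \<partial>M) = (\<integral>\<^sup>+\<omega>. H (y \<omega>, \<tau> \<omega>) \<partial>M)"
    using rc T by (intro nn_integral_cong_AE) (auto simp: H_def eval \<tau>_def st elim!: eventually_elim2)
  also have "\<dots> = (\<integral>\<^sup>+\<omega>. \<integral>\<^sup>+\<omega>'. H (y \<omega>', \<tau> \<omega>) \<partial>M \<partial>M)"
    by (rule indep_var_nn_integral[OF iv H])
  also have "\<dots> = (\<integral>\<^sup>+\<omega>. \<integral>\<^sup>+\<omega>'. h (Y (T s \<omega>) \<omega>') (Y (T t \<omega>) \<omega>') \<partial>M \<partial>M)"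
    using T
  proof (intro nn_integral_cong_AE, eventually_elim)
    case (elim \<omega>)
    show ?case
      using rc by (intro nn_integral_cong_AE) (use elim in \<open>auto simp: H_def eval \<tau>_def st elim!: eventually_mono\<close>)
  qed
  finally show ?thesis .
qed

text \<open>The null set in the hypothesis on Y depends on the time a, so a random time cannot
  simply be inserted. Conditioning on T resolves this, applied to the indicator of the negative
  half-line.\<close>

lemma (in prob_space) time_change_nonneg:
  assumes ind: "indep_processes Y T"
    and rc: "AE \<omega> in M. \<forall>t\<ge>0. ((\<lambda>u. Y u \<omega>) \<longlongrightarrow> Y t \<omega>) (at_right t)"
    and T: "AE \<omega> in M. \<forall>t\<ge>0. T t \<omega> \<ge> 0"
    and Y: "\<And>a. a \<ge> 0 \<Longrightarrow> AE \<omega> in M. Y a \<omega> \<ge> 0"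
    and Z: "Z \<in> borel_measurable M" "AE \<omega> in M. Z \<omega> = Y (T t \<omega>) \<omega>"
    and t: "t \<ge> 0"
  shows "AE \<omega> in M. Z \<omega> \<ge> 0"
proof -
  note [measurable] = Z(1)
  have "(\<integral>\<^sup>+\<omega>. indicator {..<0} (Z \<omega>) \<partial>M) = (\<integral>\<^sup>+\<omega>. indicator {..<0} (Y (T t \<omega>) \<omega>) \<partial>M)"
    by (rule nn_integral_cong_AE, use Z(2) in eventually_elim) simp
  also have "\<dots> = (\<integral>\<^sup>+\<omega>. \<integral>\<^sup>+\<omega>'. indicator {..<0} (Y (T t \<omega>) \<omega>') \<partial>M \<partial>M)"
    by (rule nn_integral_time_change[OF ind rc T _ t t, of "\<lambda>x y. indicator {..<0} x"]) measurable
  also have "\<dots> = (\<integral>\<^sup>+\<omega>. 0 \<partial>M)"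
  proof (rule nn_integral_cong_AE, use T in eventually_elim)
    case (elim \<omega>)
    then have "AE \<omega>' in M. 0 \<le> Y (T t \<omega>) \<omega>'"
      by (intro Y) (use t in simp)
    then have "(\<integral>\<^sup>+\<omega>'. indicator {..<0} (Y (T t \<omega>) \<omega>') \<partial>M) = (\<integral>\<^sup>+\<omega>'. 0 \<partial>M)"
      by (intro nn_integral_cong_AE, eventually_elim) (simp add: indicator_def)
    then show ?case by simp
  qed
  finally have "(\<integral>\<^sup>+\<omega>. indicator {..<0} (Z \<omega>) \<partial>M) = 0"
    by simp
  then have "AE \<omega> in M. indicator {..<0} (Z \<omega>) = (0 :: ennreal)"
    by (subst (asm) nn_integral_0_iff_AE) simp_all
  then show ?thesis
    by eventually_elim (simp add: indicator_def split: if_splits)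
qed

subsection \<open>Uniqueness of the Laplace transform\<close>

text \<open>On the unit interval all absolute moments are at most 1, so the Taylor remainder of the
  characteristic function is at most 2 |t|^n / n!. The moments thus determine the characteristic
  function, and Levy's uniqueness theorem finishes.\<close>

lemma real_distribution_eqI_moments:
  fixes \<mu> \<nu> :: "real measure"
  assumes "real_distribution \<mu>" "real_distribution \<nu>"
    and bnd: "AE x in \<mu>. \<bar>x\<bar> \<le> 1" "AE x in \<nu>. \<bar>x\<bar> \<le> 1"
    and eq: "\<And>k::nat. (\<integral>x. x ^ k \<partial>\<mu>) = (\<integral>x. x ^ k \<partial>\<nu>)"
  shows "\<mu> = \<nu>"
proof (rule Levy_uniqueness[OF assms(1,2)], rule ext)
  fix t :: real
  define p where "p n = (\<Sum>k\<le>n. (\<i> * t) ^ k / fact k * complex_of_real (\<integral>x. x ^ k \<partial>\<mu>))" for n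
  have lim: "(\<lambda>n. p n) \<longlonglongrightarrow> char \<kappa> t"
    if \<kappa>: "real_distribution \<kappa>" and b: "AE x in \<kappa>. \<bar>x\<bar> \<le> 1"
      and e: "\<And>k. (\<integral>x. x ^ k \<partial>\<mu>) = (\<integral>x. x ^ k \<partial>\<kappa>)" for \<kappa>
  proof -
    interpret real_distribution \<kappa> by (rule \<kappa>)
    have int: "integrable \<kappa> (\<lambda>x. x ^ k)" "integrable \<kappa> (\<lambda>x. \<bar>x\<bar> ^ k)" for k
      using b by (auto intro!: integrable_const_bound[where B=1] power_le_one simp: power_abs elim!: eventually_mono)
    have bound: "cmod (p n - char \<kappa> t) \<le> 2 * (\<bar>t\<bar> ^ n / fact n)" for n
    proof -
      have "cmod (p n - char \<kappa> t) \<le> 2 * \<bar>t\<bar> ^ n / fact n * expectation (\<lambda>x. \<bar>x\<bar> ^ n)"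
        using char_approx1[OF int(1), where n=n and t=t] by (simp add: p_def e norm_minus_commute)
      also have "\<dots> \<le> 2 * \<bar>t\<bar> ^ n / fact n * expectation (\<lambda>x. 1)"
        using b by (intro mult_left_mono integral_mono_AE int)
          (auto intro: power_le_one elim!: eventually_mono)
      finally show ?thesis using prob_space by simp
    qed
    have lim: "(\<lambda>n. 2 * (\<bar>t\<bar> ^ n / fact n)) \<longlonglongrightarrow> 0"
      using tendsto_mult[OF tendsto_const summable_LIMSEQ_zero[OF summable_exp[of "\<bar>t\<bar>"]], of 2]
      by (simp add: divide_inverse mult.commute)
    have "(\<lambda>n. p n - char \<kappa> t) \<longlonglongrightarrow> 0"
      by (rule Lim_null_comparison[OF always_eventually[OF allI[OF bound]] lim])
    then show ?thesis by (rule LIM_zero_cancel)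
  qed
  show "char \<mu> t = char \<nu> t"
    using lim[OF assms(1) bnd(1) refl] lim[OF assms(2) bnd(2) eq] by (rule LIMSEQ_unique)
qed

text \<open>
  The measures with density $e^{-x}$, pushed forward by $x \mapsto e^{-x}$, are probability measures
  on the unit interval whose moments are the values of the Laplace transform at $1, 2, \dots$.
\<close>

lemma measure_eqI_laplace:
  fixes \<mu> \<nu> :: "real measure"
  assumes sets: "sets \<mu> = sets borel" "sets \<nu> = sets borel"
    and nonneg: "AE x in \<mu>. x \<ge> 0" "AE x in \<nu>. x \<ge> 0"
    and one: "(\<integral>\<^sup>+x. ennreal (exp (- x)) \<partial>\<mu>) = 1"
    and eq: "\<And>n::nat. (\<integral>\<^sup>+x. ennreal (exp (- (real (Suc n) * x))) \<partial>\<mu>)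
                 = (\<integral>\<^sup>+x. ennreal (exp (- (real (Suc n) * x))) \<partial>\<nu>)"
  shows "\<mu> = \<nu>"
proof -
  define T where "T \<kappa> = distr (density \<kappa> (\<lambda>x. ennreal (exp (- x)))) borel (\<lambda>x. exp (- x))"
    for \<kappa> :: "real measure"
  have nn: "(\<integral>\<^sup>+w. g w \<partial>T \<kappa>) = (\<integral>\<^sup>+x. ennreal (exp (- x)) * g (exp (- x)) \<partial>\<kappa>)"
    if [measurable_cong]: "sets \<kappa> = sets borel" and [measurable]: "g \<in> borel_measurable borel" for \<kappa> g
    unfolding T_def by (simp add: nn_integral_distr nn_integral_density)
  have T: "real_distribution (T \<kappa>)" "AE x in T \<kappa>. \<bar>x\<bar> \<le> 1"
    "(\<integral>x. x ^ k \<partial>T \<kappa>) = enn2real (\<integral>\<^sup>+x. ennreal (exp (- (real (Suc k) * x))) \<partial>\<kappa>)"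
    if s[measurable_cong]: "sets \<kappa> = sets borel" and n: "AE x in \<kappa>. x \<ge> 0"
      and o: "(\<integral>\<^sup>+x. ennreal (exp (- x)) \<partial>\<kappa>) = 1" for \<kappa> k
  proof -
    have "emeasure (T \<kappa>) (space (T \<kappa>)) = (\<integral>\<^sup>+w. 1 \<partial>T \<kappa>)"
      by simp
    also have "\<dots> = 1"
      by (subst nn[OF s]) (simp_all add: o)
    finally have "prob_space (T \<kappa>)" by (rule prob_spaceI)
    then show "real_distribution (T \<kappa>)"
      by (simp add: real_distribution_def real_distribution_axioms_def T_def)
    show "AE x in T \<kappa>. \<bar>x\<bar> \<le> 1"
      unfolding T_def using n by (subst AE_distr_iff) (auto simp: AE_density elim!: eventually_mono)
    have "AE x in T \<kappa>. 0 \<le> x ^ k"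
      unfolding T_def by (subst AE_distr_iff) (auto simp: AE_density)
    then have "(\<integral>x. x ^ k \<partial>T \<kappa>) = enn2real (\<integral>\<^sup>+w. ennreal (w ^ k) \<partial>T \<kappa>)"
      by (intro integral_eq_nn_integral) (auto simp: T_def)
    also have "(\<integral>\<^sup>+w. ennreal (w ^ k) \<partial>T \<kappa>) = (\<integral>\<^sup>+x. ennreal (exp (- (real (Suc k) * x))) \<partial>\<kappa>)"
      by (subst nn[OF s])
         (auto simp: algebra_simps simp flip: ennreal_mult exp_of_nat_mult exp_add intro!: nn_integral_cong)
    finally show "(\<integral>x. x ^ k \<partial>T \<kappa>) = enn2real (\<integral>\<^sup>+x. ennreal (exp (- (real (Suc k) * x))) \<partial>\<kappa>)" .
  qed
  have one': "(\<integral>\<^sup>+x. ennreal (exp (- x)) \<partial>\<nu>) = 1"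
    using eq[of 0] one by simp
  note T\<mu> = T[OF sets(1) nonneg(1) one] and T\<nu> = T[OF sets(2) nonneg(2) one']
  have eqT: "T \<mu> = T \<nu>"
    by (rule real_distribution_eqI_moments[OF T\<mu>(1) T\<nu>(1) T\<mu>(2) T\<nu>(2)]) (simp only: T\<mu>(3) T\<nu>(3) eq)
  show ?thesis
  proof (rule measure_eqI)
    fix A assume "A \<in> sets \<mu>"
    then have A[measurable]: "A \<in> sets borel" using sets by simp
    \<comment> \<open>\<open>g\<close> undoes the weight and the change of variable: at w = exp(-x)
      the factor 1/w cancels the density and -ln w returns x. Hence the measure of A is an integral
      against the transformed measure.\<close>
    define g where "g w = (if w > 0 then indicator A (- ln w) * ennreal (1 / w) else 0)" for w :: real
    have g[measurable]: "g \<in> borel_measurable borel" unfolding g_def by measurable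
    have *: "ennreal (exp (- x)) * g (exp (- x)) = indicator A x" for x
      by (auto simp: g_def simp flip: ennreal_mult split: split_indicator)
    have "emeasure \<kappa> A = (\<integral>\<^sup>+w. g w \<partial>T \<kappa>)" if "sets \<kappa> = sets borel" for \<kappa>
      using A that by (subst nn[OF that g]) (simp add: *)
    then show "emeasure \<mu> A = emeasure \<nu> A"
      using eqT sets by simp
  qed (use sets in simp)
qed

subsection \<open>Subordinators\<close>

text \<open>The Gamma integral after the substitution c x. It serves twice in identifying the
  potential measure: a = 1 for the integral over time, a = \<beta> for the candidate
  density.\<close>

lemma nn_integral_powr_exp:
  fixes a c :: real
  assumes "a > 0" "c > 0"
  shows "(\<integral>\<^sup>+x. ennreal (x powr (a - 1) * exp (- (c * x))) * indicator {0<..} x \<partial>lborel)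
       = ennreal (Gamma a / c powr a)"
proof -
  define f where "f x = ennreal (x powr (a - 1) * exp (- x)) * indicator {0<..} x" for x :: real
  have [measurable]: "f \<in> borel_measurable borel" unfolding f_def by measurable
  have "(\<integral>\<^sup>+x. ennreal (x powr (a - 1) / exp x) * indicator {0..} x \<partial>lborel) = ennreal (Gamma a)"
    using Gamma_integral_real[OF assms(1)] by (intro nn_integral_has_integral_lebesgue') auto
  moreover have "(\<integral>\<^sup>+x. ennreal (x powr (a - 1) / exp x) * indicator {0..} x \<partial>lborel) = (\<integral>\<^sup>+x. f x \<partial>lborel)"
    by (intro nn_integral_cong) (simp add: f_def exp_minus divide_inverse indicator_def)
  ultimately have "ennreal (Gamma a) = ennreal c * (\<integral>\<^sup>+x. f (0 + c * x) \<partial>lborel)"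
    using nn_integral_real_affine[of f c 0] assms by simp
  also have "(\<integral>\<^sup>+x. f (0 + c * x) \<partial>lborel)
      = (\<integral>\<^sup>+x. ennreal (c powr (a - 1)) * (ennreal (x powr (a - 1) * exp (- (c * x))) * indicator {0<..} x) \<partial>lborel)"
  proof (rule nn_integral_cong)
    fix x :: real
    show "f (0 + c * x) = ennreal (c powr (a - 1)) * (ennreal (x powr (a - 1) * exp (- (c * x))) * indicator {0<..} x)"
      using assms
      by (cases "x > 0")
         (simp_all add: f_def powr_mult indicator_def zero_less_mult_iff mult.assoc flip: ennreal_mult)
  qed
  also have "\<dots> = ennreal (c powr (a - 1)) *
      (\<integral>\<^sup>+x. ennreal (x powr (a - 1) * exp (- (c * x))) * indicator {0<..} x \<partial>lborel)" (is "_ = _ * ?I")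
    by (rule nn_integral_cmult) measurable
  finally have *: "ennreal (Gamma a) = ennreal (c powr a) * ?I"
    using assms by (simp add: powr_diff flip: mult.assoc ennreal_mult)
  have "?I = ennreal (1 / c powr a) * (ennreal (c powr a) * ?I)"
    using assms by (simp flip: mult.assoc ennreal_mult)
  also have "\<dots> = ennreal (Gamma a / c powr a)"
    using assms by (simp flip: * ennreal_mult)
  finally show ?thesis .
qed

context prob_space
begin

text \<open>The increments over 0, s, t are independent, and stationarity replaces the second one by
  a fresh copy of \<open>Z (t - s)\<close>. The definition speaks of increments only, so
  \<open>Z s\<close> enters as \<open>Z s - Z 0\<close>, at the cost of a null set.\<close>

lemma levy_process_nn_integral_increment:
  assumes Z: "levy_process Z" and st: "0 \<le> s" "s \<le> t"
    and h[measurable]: "case_prod h \<in> borel_measurable (borel \<Otimes>\<^sub>M borel)"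
  shows "(\<integral>\<^sup>+\<omega>. h (Z s \<omega>) (Z t \<omega> - Z s \<omega>) \<partial>M) = (\<integral>\<^sup>+\<omega>. \<integral>\<^sup>+\<omega>'. h (Z s \<omega>) (Z (t - s) \<omega>') \<partial>M \<partial>M)"
proof -
  define u where "u i = (if i = 0 then 0 else if i = Suc 0 then s else t)" for i :: nat
  have zero: "AE \<omega> in M. Z 0 \<omega> = 0"
    and distr: "distr M borel (\<lambda>\<omega>. Z t \<omega> - Z s \<omega>) = distr M borel (Z (t - s))"
  proof -
    have "distr M borel (\<lambda>\<omega>. Z (s + (t - s)) \<omega> - Z s \<omega>) = distr M borel (Z (t - s))"
      using Z st unfolding levy_process_def by (metis diff_ge_0_iff_ge)
    then show "distr M borel (\<lambda>\<omega>. Z t \<omega> - Z s \<omega>) = distr M borel (Z (t - s))"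
      by simp
  qed (use Z in \<open>simp add: levy_process_def\<close>)
  have rv[measurable]: "random_variable borel (Z s)" "random_variable borel (Z t)"
    "random_variable borel (Z 0)" "random_variable borel (Z (t - s))"
    using Z st unfolding levy_process_def by auto
  have "indep_vars (\<lambda>_. borel) (\<lambda>i \<omega>. Z (u (Suc i)) \<omega> - Z (u i) \<omega>) {..<2}"
  proof -
    have *: "0 \<le> u 0 \<and> (\<forall>i<2. u i \<le> u (Suc i))" using st by (simp add: u_def)
    from Z have "\<forall>(n::nat) (u :: nat \<Rightarrow> real). 0 \<le> u 0 \<and> (\<forall>i<n. u i \<le> u (Suc i)) \<longrightarrow>
        indep_vars (\<lambda>_. borel) (\<lambda>i \<omega>. Z (u (Suc i)) \<omega> - Z (u i) \<omega>) {..<n}"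
      by (simp add: levy_process_def)
    from this[rule_format, OF *] show ?thesis .
  qed
  from indep_var_restrict[OF this, of "{1}" "{0}"]
  have "indep_var (PiM {1} (\<lambda>_. borel)) (\<lambda>\<omega>. \<lambda>i\<in>{1}. Z (u (Suc i)) \<omega> - Z (u i) \<omega>)
          (PiM {0} (\<lambda>_. borel)) (\<lambda>\<omega>. \<lambda>i\<in>{0}. Z (u (Suc i)) \<omega> - Z (u i) \<omega>)"
    by simp
  from indep_var_compose[OF this measurable_component_singleton measurable_component_singleton, of 1 0]
  have "indep_var borel (\<lambda>\<omega>. Z t \<omega> - Z s \<omega>) borel (\<lambda>\<omega>. Z s \<omega> - Z 0 \<omega>)"
    by (simp add: comp_def u_def)
  note ind = indep_var_nn_integral[OF this, of "\<lambda>z. h (snd z) (fst z)"]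
  have "(\<integral>\<^sup>+\<omega>. h (Z s \<omega>) (Z t \<omega> - Z s \<omega>) \<partial>M) = (\<integral>\<^sup>+\<omega>. h (Z s \<omega> - Z 0 \<omega>) (Z t \<omega> - Z s \<omega>) \<partial>M)"
    using zero by (intro nn_integral_cong_AE) auto
  also have "\<dots> = (\<integral>\<^sup>+\<omega>. \<integral>\<^sup>+\<omega>'. h (Z s \<omega> - Z 0 \<omega>) (Z t \<omega>' - Z s \<omega>') \<partial>M \<partial>M)"
    using ind by simp
  also have "\<dots> = (\<integral>\<^sup>+\<omega>. \<integral>\<^sup>+\<omega>'. h (Z s \<omega>) (Z t \<omega>' - Z s \<omega>') \<partial>M \<partial>M)"
    using zero by (intro nn_integral_cong_AE) auto
  also have "\<dots> = (\<integral>\<^sup>+\<omega>. \<integral>\<^sup>+\<omega>'. h (Z s \<omega>) (Z (t - s) \<omega>') \<partial>M \<partial>M)"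
  proof (rule nn_integral_cong)
    fix \<omega>
    have "(\<integral>\<^sup>+\<omega>'. h (Z s \<omega>) (Z t \<omega>' - Z s \<omega>') \<partial>M) = (\<integral>\<^sup>+x. h (Z s \<omega>) x \<partial>distr M borel (\<lambda>\<omega>. Z t \<omega> - Z s \<omega>))"
      by (simp add: nn_integral_distr)
    also have "\<dots> = (\<integral>\<^sup>+\<omega>'. h (Z s \<omega>) (Z (t - s) \<omega>') \<partial>M)"
      unfolding distr by (simp add: nn_integral_distr)
    finally show "(\<integral>\<^sup>+\<omega>'. h (Z s \<omega>) (Z t \<omega>' - Z s \<omega>') \<partial>M) = (\<integral>\<^sup>+\<omega>'. h (Z s \<omega>) (Z (t - s) \<omega>') \<partial>M)" .
  qed
  finally show ?thesis .
qed

lemma levy_process_measurable: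
  "levy_process Z \<Longrightarrow> t \<ge> 0 \<Longrightarrow> random_variable borel (Z t)"
  by (simp add: levy_process_def)

lemma levy_process_right_continuous:
  "levy_process Z \<Longrightarrow> AE \<omega> in M. \<forall>t\<ge>0. ((\<lambda>u. Z u \<omega>) \<longlongrightarrow> Z t \<omega>) (at_right t)"
  by (simp add: levy_process_def)

lemma subordinator_levy: "subordinator f D \<Longrightarrow> levy_process D"
  by (simp add: subordinator_def)

lemma subordinator_mono:
  "subordinator f D \<Longrightarrow> AE \<omega> in M. \<forall>s t. 0 \<le> s \<and> s \<le> t \<longrightarrow> D s \<omega> \<le> D t \<omega>"
  by (simp add: subordinator_def)

lemma subordinator_nonneg:
  assumes "subordinator f D"
  shows "AE \<omega> in M. \<forall>t\<ge>0. 0 \<le> D t \<omega>"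
proof -
  have "AE \<omega> in M. D 0 \<omega> = 0"
    using assms by (simp add: subordinator_def levy_process_def)
  with subordinator_mono[OF assms] show ?thesis
    by eventually_elim (metis order.refl)
qed

lemma subordinator_laplace:
  assumes D: "subordinator f D" and "t \<ge> 0" "s > 0"
  shows "(\<integral>\<^sup>+\<omega>. ennreal (exp (- (s * D t \<omega>))) \<partial>M) = ennreal (exp (- (t * f s)))"
proof -
  have [measurable]: "random_variable borel (D t)"
    using levy_process_measurable[OF subordinator_levy[OF D]] assms by simp
  have "AE \<omega> in M. norm (exp (- (s * D t \<omega>))) \<le> 1"
    using subordinator_nonneg[OF D] by eventually_elim (use assms in simp)
  then have "integrable M (\<lambda>\<omega>. exp (- (s * D t \<omega>)))"
    by (rule integrable_const_bound) measurable
  then have "(\<integral>\<^sup>+\<omega>. ennreal (exp (- (s * D t \<omega>))) \<partial>M) = ennreal (expectation (\<lambda>\<omega>. exp (- (s * D t \<omega>))))"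
    by (intro nn_integral_eq_integral) auto
  then show ?thesis
    using assms by (simp add: subordinator_def)
qed

text \<open>$\sum_n E\,e^{-D(n)}$ is a convergent geometric series, so $e^{-D(n)} \to 0$ almost surely.\<close>

lemma subordinator_at_top:
  assumes D: "subordinator f D" and f: "f 1 > 0"
  shows "AE \<omega> in M. filterlim (\<lambda>t. D t \<omega>) at_top at_top"
proof -
  have [measurable]: "random_variable borel (D t)" if "t \<ge> 0" for t
    using levy_process_measurable[OF subordinator_levy[OF D]] that by simp
  have "summable (\<lambda>n. exp (- f 1) ^ n)"
    using f by (intro summable_geometric) simp
  then have sm: "summable (\<lambda>n::nat. exp (- (real n * f 1)))"
    by (simp flip: exp_of_nat_mult)
  have "(\<integral>\<^sup>+\<omega>. (\<Sum>n. ennreal (exp (- D (real n) \<omega>))) \<partial>M) = (\<Sum>n. \<integral>\<^sup>+\<omega>. ennreal (exp (- D (real n) \<omega>)) \<partial>M)"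
    by (rule nn_integral_suminf) simp
  also have "\<dots> = (\<Sum>n. ennreal (exp (- (real n * f 1))))"
    using subordinator_laplace[OF D, where s=1] by simp
  also have "\<dots> \<noteq> \<infinity>"
    by (subst suminf_ennreal2[OF _ sm]) simp_all
  finally have "AE \<omega> in M. (\<Sum>n. ennreal (exp (- D (real n) \<omega>))) \<noteq> \<infinity>"
    by (intro nn_integral_PInf_AE) auto
  with subordinator_mono[OF D] show ?thesis
  proof eventually_elim
    case (elim \<omega>)
    have "summable (\<lambda>n. exp (- D (real n) \<omega>))"
      using elim(2) by (intro summable_suminf_not_top) auto
    then have lim: "(\<lambda>n. exp (- D (real n) \<omega>)) \<longlonglongrightarrow> 0"
      by (rule summable_LIMSEQ_zero)
    show ?case
      unfolding filterlim_at_top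
    proof
      fix Z
      have "\<forall>\<^sub>F n in sequentially. exp (- D (real n) \<omega>) < exp (- Z)"
        by (rule order_tendstoD(2)[OF lim]) simp
      then obtain n where n: "Z < D (real n) \<omega>"
        by (auto simp: eventually_sequentially)
      \<comment> \<open>Monotone paths carry the divergence along the integers over to real
        times.\<close>
      then have "Z \<le> D t \<omega>" if "t \<ge> real n" for t
        using elim(1)[rule_format, of "real n" t] that by simp
      then show "\<forall>\<^sub>F t in at_top. Z \<le> D t \<omega>"
        by (auto simp: eventually_at_top_linorder)
    qed
  qed
qed

lemma subordinator_right_eval:
  assumes D: "subordinator f D"
  shows "(\<lambda>z. right_eval (\<lambda>u. D u (snd z)) (fst z)) \<in> borel_measurable (lborel \<Otimes>\<^sub>M M)" (is ?m)
    and "AE \<omega> in M. \<forall>t\<ge>0. right_eval (\<lambda>u. D u \<omega>) t = D t \<omega>" (is ?e)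
proof -
  have [measurable]: "random_variable borel (D t)" if "t \<ge> 0" for t
    using levy_process_measurable[OF subordinator_levy[OF D]] that by simp
  show ?m
    by (rule borel_measurable_right_eval) (auto intro!: measurable_compose[OF measurable_snd])
  show ?e
    using levy_process_right_continuous[OF subordinator_levy[OF D]]
    by eventually_elim (auto intro: right_eval_eq)
qed

end

section \<open>Potential measure of the stable subordinator\<close>

locale stable_subordinator = prob_space M for M :: "'a measure" +
  fixes \<beta> :: real and S :: "real \<Rightarrow> 'a \<Rightarrow> real"
  assumes pos: "0 < \<beta>" and less_one: "\<beta> < 1"
    and stable: "subordinator (\<lambda>s. s powr \<beta>) S"
begin

text \<open>A jointly measurable version of \<open>S\<close>, so that integrals over time and over
  the sample space may be exchanged; almost surely it agrees with \<open>S\<close> at all times t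
  \<ge> 0 simultaneously.\<close>

definition R :: "real \<Rightarrow> 'a \<Rightarrow> real" where
  "R r \<omega> = right_eval (\<lambda>u. S u \<omega>) r"

lemma R_measurable[measurable]: "(\<lambda>(r, \<omega>). R r \<omega>) \<in> borel_measurable (lborel \<Otimes>\<^sub>M M)"
  using subordinator_right_eval(1)[OF stable] by (simp add: R_def case_prod_beta')

lemma R_measurable'[measurable]: "(\<lambda>z. R (fst z) (snd z)) \<in> borel_measurable (lborel \<Otimes>\<^sub>M M)"
  using R_measurable by (simp add: case_prod_beta')

lemma R_measurable_snd[measurable]: "R r \<in> borel_measurable M"
  using measurable_compose[OF measurable_Pair1' R_measurable, of r] by simp

lemma R_eq: "AE \<omega> in M. \<forall>t\<ge>0. R t \<omega> = S t \<omega>"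
  unfolding R_def by (rule subordinator_right_eval(2)[OF stable])

lemma S_measurable[measurable]: "t \<ge> 0 \<Longrightarrow> S t \<in> borel_measurable M"
  using levy_process_measurable[OF subordinator_levy[OF stable]] .

text \<open>Density of the potential measure, which assigns to a set the expected Lebesgue time that
  \<open>S\<close> spends in it. The factor 1 / Gamma(\<beta>) is forced by the Laplace transform
  s^(-\<beta>).\<close>

definition potential_density :: "real \<Rightarrow> ennreal" where
  "potential_density x = ennreal (x powr (\<beta> - 1) / Gamma \<beta>) * indicator {0<..} x"

lemma potential_density_measurable[measurable]: "potential_density \<in> borel_measurable borel"
  unfolding potential_density_def by measurable

text \<open>
  The potential measure of the subordinator has Laplace transform
  $\int_0^\infty e^{-r s^\beta}\,dr = s^{-\beta}$.
\<close>

lemma nn_integral_potential: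
  assumes g[measurable]: "g \<in> borel_measurable borel"
  shows "(\<integral>\<^sup>+r. (\<integral>\<^sup>+\<omega>. g (R r \<omega>) \<partial>M) * indicator {0<..} r \<partial>lborel)
       = (\<integral>\<^sup>+x. g x * potential_density x \<partial>lborel)"
proof -
  define U where "U = distr (density (lborel \<Otimes>\<^sub>M M) (\<lambda>z. indicator {0<..} (fst z))) borel (\<lambda>(r, \<omega>). R r \<omega>)"
  define V where "V = density lborel potential_density"
  have U: "(\<integral>\<^sup>+x. g x \<partial>U) = (\<integral>\<^sup>+r. (\<integral>\<^sup>+\<omega>. g (R r \<omega>) \<partial>M) * indicator {0<..} r \<partial>lborel)"
    if [measurable]: "g \<in> borel_measurable borel" for g
  proof -
    have "(\<integral>\<^sup>+x. g x \<partial>U) = (\<integral>\<^sup>+z. g (R (fst z) (snd z)) * indicator {0<..} (fst z) \<partial>(lborel \<Otimes>\<^sub>M M))"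
      unfolding U_def by (simp add: nn_integral_distr nn_integral_density case_prod_beta' mult.commute)
    also have "\<dots> = (\<integral>\<^sup>+r. \<integral>\<^sup>+\<omega>. g (R r \<omega>) * indicator {0<..} r \<partial>M \<partial>lborel)"
      using nn_integral_fst[of "\<lambda>z. g (R (fst z) (snd z)) * indicator {0<..} (fst z)" lborel] by simp
    also have "\<dots> = (\<integral>\<^sup>+r. (\<integral>\<^sup>+\<omega>. g (R r \<omega>) \<partial>M) * indicator {0<..} r \<partial>lborel)"
      by (intro nn_integral_cong nn_integral_multc) auto
    finally show ?thesis .
  qed
  have V: "(\<integral>\<^sup>+x. g x \<partial>V) = (\<integral>\<^sup>+x. g x * potential_density x \<partial>lborel)"
    if [measurable]: "g \<in> borel_measurable borel" for g
    unfolding V_def by (simp add: nn_integral_density mult.commute)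
  \<comment> \<open>By Tonelli the transform is an exponential integral in r with rate c^\<beta>,
    the case a = 1 of \<open>nn_integral_powr_exp\<close>; this is where the trivial power
    \<open>r powr (1 - 1)\<close> comes from.\<close>
  have lapU: "(\<integral>\<^sup>+x. ennreal (exp (- (c * x))) \<partial>U) = ennreal (1 / c powr \<beta>)" if "c > 0" for c
  proof -
    have "(\<integral>\<^sup>+\<omega>. ennreal (exp (- (c * R r \<omega>))) \<partial>M) * indicator {0<..} r
        = ennreal (r powr (1 - 1) * exp (- (c powr \<beta> * r))) * indicator {0<..} r" for r :: real
    proof (cases "r > 0")
      case True
      have "(\<integral>\<^sup>+\<omega>. ennreal (exp (- (c * R r \<omega>))) \<partial>M) = (\<integral>\<^sup>+\<omega>. ennreal (exp (- (c * S r \<omega>))) \<partial>M)"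
        by (rule nn_integral_cong_AE, use R_eq in eventually_elim) (use True in simp)
      then show ?thesis
        using True that subordinator_laplace[OF stable, of r c] by (simp add: mult.commute)
    qed simp
    then show ?thesis
      using nn_integral_powr_exp[of 1 "c powr \<beta>"] that by (subst U) simp_all
  qed
  have lapV: "(\<integral>\<^sup>+x. ennreal (exp (- (c * x))) \<partial>V) = ennreal (1 / c powr \<beta>)" if "c > 0" for c
  proof -
    have "(\<integral>\<^sup>+x. ennreal (exp (- (c * x))) \<partial>V)
        = (\<integral>\<^sup>+x. ennreal (1 / Gamma \<beta>) * (ennreal (x powr (\<beta> - 1) * exp (- (c * x))) * indicator {0<..} x) \<partial>lborel)"
      using pos Gamma_real_pos[OF pos]
      by (subst V) (auto simp: potential_density_def mult_ac simp flip: ennreal_mult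
                         split: split_indicator intro!: nn_integral_cong)
    also have "\<dots> = ennreal (1 / Gamma \<beta>) * ennreal (Gamma \<beta> / c powr \<beta>)"
      using nn_integral_powr_exp[OF pos that] by (subst nn_integral_cmult) auto
    also have "\<dots> = ennreal (1 / c powr \<beta>)"
      using Gamma_real_pos[OF pos] by (simp flip: ennreal_mult)
    finally show ?thesis .
  qed
  \<comment> \<open>At argument 1 both transforms equal 1, which is the normalisation that
    \<open>measure_eqI_laplace\<close> asks for.\<close>
  have "U = V"
  proof (rule measure_eqI_laplace)
    have *: "(\<integral>\<^sup>+\<omega>. indicator {..<0} (R r \<omega>) \<partial>M) * indicator {0<..} r = (0::ennreal)" for r
    proof (cases "r > 0")
      case True
      have "(\<integral>\<^sup>+\<omega>. indicator {..<0} (R r \<omega>) \<partial>M) = (\<integral>\<^sup>+\<omega>. 0 \<partial>M)"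
        by (rule nn_integral_cong_AE, use R_eq subordinator_nonneg[OF stable] in eventually_elim)
           (use True in \<open>simp add: indicator_def not_less less_imp_le\<close>)
      then show ?thesis by simp
    qed simp
    have "(\<integral>\<^sup>+x. indicator {..<0} x \<partial>U) = 0"
      by (subst U) (simp_all only: *, simp_all)
    then have "AE x in U. indicator {..<0::real} x = (0::ennreal)"
      by (subst (asm) nn_integral_0_iff_AE) (simp_all add: U_def)
    then show "AE x in U. x \<ge> 0"
      by eventually_elim (simp add: indicator_def split: if_splits)
    show "AE x in V. x \<ge> 0"
      unfolding V_def by (auto simp: AE_density potential_density_def indicator_def)
  qed (use lapU lapV lapU[of 1] in \<open>simp_all add: U_def V_def\<close>)
  then show ?thesis using U[OF g] V[OF g] by simp
qed

end

subsection \<open>The inverse stable subordinator\<close>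

context
  fixes S :: "real \<Rightarrow> 'a \<Rightarrow> real" and \<omega> :: 'a
  assumes mono: "\<And>s t. 0 \<le> s \<Longrightarrow> s \<le> t \<Longrightarrow> S s \<omega> \<le> S t \<omega>"
    and top: "filterlim (\<lambda>t. S t \<omega>) at_top at_top"
begin

lemma inverse_process_set:
  "{r. 0 \<le> r \<and> S r \<omega> > t} \<noteq> {}" "bdd_below {r. 0 \<le> r \<and> S r \<omega> > t}"
proof -
  have "\<forall>\<^sub>F r in at_top. t < S r \<omega> \<and> 0 \<le> r"
    using top by (intro eventually_conj eventually_ge_at_top) (auto simp: filterlim_at_top_dense)
  then show "{r. 0 \<le> r \<and> S r \<omega> > t} \<noteq> {}"
    using eventually_happens'[of at_top "\<lambda>r. t < S r \<omega> \<and> 0 \<le> r"] by (auto simp: trivial_limit_at_top_linorder)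
  show "bdd_below {r. 0 \<le> r \<and> S r \<omega> > t}"
    by (rule bdd_belowI[of _ 0]) simp
qed

lemma inverse_process_nonneg: "0 \<le> inverse_process S t \<omega>"
  unfolding inverse_process_def by (rule cInf_greatest) (use inverse_process_set in auto)

lemma inverse_process_gt_imp: "0 \<le> r \<Longrightarrow> r < inverse_process S t \<omega> \<Longrightarrow> S r \<omega> \<le> t"
  using cInf_lower[OF _ inverse_process_set(2), of r t] by (force simp: inverse_process_def)

lemma inverse_process_less_imp:
  assumes "inverse_process S t \<omega> < r"
  shows "t < S r \<omega>"
proof -
  obtain x where "0 \<le> x" "t < S x \<omega>" "x < r"
    using cInf_lessD[OF inverse_process_set(1), of t r] assms by (auto simp: inverse_process_def)
  then show ?thesis using mono[of x r] by simp
qed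

lemma inverse_process_le: "0 \<le> r \<Longrightarrow> t < S r \<omega> \<Longrightarrow> inverse_process S t \<omega> \<le> r"
  by (meson inverse_process_gt_imp not_le)

lemma inverse_process_mono: "s \<le> t \<Longrightarrow> inverse_process S s \<omega> \<le> inverse_process S t \<omega>"
  by (meson dense inverse_process_le inverse_process_less_imp inverse_process_nonneg less_le_trans
      le_less_trans less_imp_le not_le)

text \<open>Choose r strictly between the inverse at t and b. Then \<open>S r\<close> exceeds t
  strictly, hence also exceeds every u slightly above t, and the inverse at u is at most r.\<close>

lemma inverse_process_eventually_less:
  assumes "inverse_process S t \<omega> < b"
  shows "\<forall>\<^sub>F u in at_right t. inverse_process S u \<omega> < b"
proof -
  obtain r where r: "inverse_process S t \<omega> < r" "r < b"
    using dense assms by blast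
  have "0 \<le> r" using inverse_process_nonneg[of t] r by linarith
  then have "inverse_process S u \<omega> < b" if "u < S r \<omega>" for u
    using inverse_process_le[of r u] r that by simp
  then show ?thesis
    using inverse_process_less_imp[OF r(1)] eventually_at_right_less[of t]
    by (auto simp: eventually_at_right_field)
qed

text \<open>The inverse is nondecreasing and right-continuous, so its values approach the value a at
  t from above and the right limit of Y at a applies. The inverse may also stay equal to a on an
  interval, a case that \<open>at_right a\<close> leaves out and that is split off at the
  end.\<close>

lemma right_continuous_time_change:
  fixes Y :: "real \<Rightarrow> real"
  assumes Y: "\<And>t. t \<ge> 0 \<Longrightarrow> (Y \<longlongrightarrow> Y t) (at_right t)"
  shows "((\<lambda>u. Y (inverse_process S u \<omega>)) \<longlongrightarrow> Y (inverse_process S t \<omega>)) (at_right t)"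
proof (rule tendstoI)
  fix e :: real assume e: "e > 0"
  define a where "a = inverse_process S t \<omega>"
  have "\<forall>\<^sub>F v in at_right a. dist (Y v) (Y a) < e"
    by (rule tendstoD[OF Y e]) (simp add: a_def inverse_process_nonneg)
  then obtain b where b: "b > a" "\<And>v. a < v \<Longrightarrow> v < b \<Longrightarrow> dist (Y v) (Y a) < e"
    by (auto simp: eventually_at_right_field)
  have "\<forall>\<^sub>F u in at_right t. inverse_process S u \<omega> < b"
    using b(1) by (intro inverse_process_eventually_less) (simp add: a_def)
  moreover have "\<forall>\<^sub>F u in at_right t. a \<le> inverse_process S u \<omega>"
    using eventually_at_right_less[of t] by eventually_elim (simp add: a_def inverse_process_mono)
  ultimately show "\<forall>\<^sub>F u in at_right t. dist (Y (inverse_process S u \<omega>)) (Y (inverse_process S t \<omega>)) < e"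
  proof eventually_elim
    case (elim u)
    then show ?case using b(2)[of "inverse_process S u \<omega>"] e
      by (cases "inverse_process S u \<omega> = a") (simp_all add: a_def)
  qed
qed

text \<open>The path is at most t before the inverse time a and above t after it; only the
  Lebesgue-null point a is undecided. Writing the inverse as an integral over time is what makes its
  moments accessible to Tonelli.\<close>

lemma inverse_process_occupation:
  "(\<integral>\<^sup>+r. indicator {..t} (S r \<omega>) * indicator {0<..} r \<partial>lborel) = ennreal (inverse_process S t \<omega>)"
proof -
  define a where "a = inverse_process S t \<omega>"
  have "AE r in lborel. indicator {..t} (S r \<omega>) * indicator {0<..} r = (indicator {0<..<a} r :: ennreal)"
    using AE_lborel_singleton[of a]
  proof eventually_elim
    case (elim r)
    have "r < a \<Longrightarrow> 0 \<le> r \<Longrightarrow> S r \<omega> \<le> t" "a < r \<Longrightarrow> t < S r \<omega>"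
      unfolding a_def by (rule inverse_process_gt_imp inverse_process_less_imp; assumption)+
    with elim show ?case by (auto simp: indicator_def)
  qed
  then have "(\<integral>\<^sup>+r. indicator {..t} (S r \<omega>) * indicator {0<..} r \<partial>lborel) = (\<integral>\<^sup>+r. indicator {0<..<a} r \<partial>lborel)"
    by (rule nn_integral_cong_AE)
  then show ?thesis
    using inverse_process_nonneg[of t] by (simp add: a_def)
qed

end

section \<open>First and second moments of the inverse stable subordinator\<close>

context stable_subordinator
begin

abbreviation E :: "real \<Rightarrow> 'a \<Rightarrow> real" where "E \<equiv> inverse_process S"

text \<open>For t \<ge> 0 this is the mass that the potential measure gives to [0,t], hence the mean
  of \<open>E t\<close>.\<close>

definition renewal :: "real \<Rightarrow> real" where
  "renewal t = t powr \<beta> / Gamma (1 + \<beta>)"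

text \<open>For 0 \<le> s \<le> t this is the part of the mean of \<open>E s * E t\<close> that
  comes from pairs of times a < b with S_a \<le> s and S_b \<le> t.\<close>

definition cross :: "real \<Rightarrow> real \<Rightarrow> ennreal" where
  "cross s t = (\<integral>\<^sup>+x. indicator {..s} x * ennreal (renewal (t - x)) * potential_density x \<partial>lborel)"

lemma renewal_measurable[measurable]: "renewal \<in> borel_measurable borel"
  unfolding renewal_def[abs_def] by measurable

lemma renewal_nonneg[simp]: "0 \<le> renewal t"
  using Gamma_real_pos[of "1 + \<beta>"] pos by (simp add: renewal_def)

lemma nn_integral_potential_density:
  assumes "t \<ge> 0"
  shows "(\<integral>\<^sup>+x. indicator {..t} x * potential_density x \<partial>lborel) = ennreal (renewal t)"
proof -
  have G: "Gamma \<beta> > 0" using pos by (rule Gamma_real_pos)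
  have "((\<lambda>x. x powr (\<beta> - 1)) has_integral (t powr (\<beta> - 1 + 1) / (\<beta> - 1 + 1))) {0..t}"
    using pos assms by (intro has_integral_powr_from_0) auto
  then have "((\<lambda>x. x powr (\<beta> - 1) / Gamma \<beta>) has_integral (t powr \<beta> / \<beta> / Gamma \<beta>)) {0..t}"
    by (intro has_integral_divide) simp
  then have "(\<integral>\<^sup>+x. ennreal (x powr (\<beta> - 1) / Gamma \<beta>) * indicator {0..t} x \<partial>lborel)
      = ennreal (t powr \<beta> / \<beta> / Gamma \<beta>)"
    by (intro nn_integral_has_integral_lebesgue') (use G in auto)
  moreover have "t powr \<beta> / \<beta> / Gamma \<beta> = renewal t"
  proof -
    have "\<beta> \<notin> \<int>\<^sub>\<le>\<^sub>0" using pos nonpos_Ints_nonpos[of \<beta>] by auto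
    then show ?thesis using Gamma_plus1[of \<beta>] by (simp add: renewal_def add.commute)
  qed
  moreover have "(\<integral>\<^sup>+x. ennreal (x powr (\<beta> - 1) / Gamma \<beta>) * indicator {0..t} x \<partial>lborel)
      = (\<integral>\<^sup>+x. indicator {..t} x * potential_density x \<partial>lborel)"
    by (intro nn_integral_cong) (auto simp: potential_density_def indicator_def)
  ultimately show ?thesis by simp
qed

lemma S_good:
  "AE \<omega> in M. (\<forall>s t. 0 \<le> s \<longrightarrow> s \<le> t \<longrightarrow> S s \<omega> \<le> S t \<omega>) \<and> filterlim (\<lambda>t. S t \<omega>) at_top at_top \<and>
     (\<forall>t\<ge>0. R t \<omega> = S t \<omega>)"
proof -
  have "AE \<omega> in M. filterlim (\<lambda>t. S t \<omega>) at_top at_top"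
    by (rule subordinator_at_top[OF stable]) simp
  with subordinator_mono[OF stable] R_eq show ?thesis
    by eventually_elim blast
qed

lemma E_nonneg: "AE \<omega> in M. \<forall>t. 0 \<le> E t \<omega>"
  using S_good by eventually_elim (blast intro: inverse_process_nonneg)

lemma E_occupation:
  "AE \<omega> in M. (\<integral>\<^sup>+r. indicator {..t} (R r \<omega>) * indicator {0<..} r \<partial>lborel) = ennreal (E t \<omega>)"
  using S_good
proof eventually_elim
  case (elim \<omega>)
  have "(\<integral>\<^sup>+r. indicator {..t} (R r \<omega>) * indicator {0<..} r \<partial>lborel)
      = (\<integral>\<^sup>+r. indicator {..t} (S r \<omega>) * indicator {0<..} r \<partial>lborel)"
    by (rule nn_integral_cong) (use elim in \<open>simp add: indicator_def\<close>)
  also have "\<dots> = ennreal (E t \<omega>)"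
    by (rule inverse_process_occupation) (use elim in blast)+
  finally show ?case .
qed

lemma nn_integral_E:
  assumes "t \<ge> 0"
  shows "(\<integral>\<^sup>+\<omega>. ennreal (E t \<omega>) \<partial>M) = ennreal (renewal t)"
proof -
  interpret LM: pair_sigma_finite lborel M ..
  have "(\<integral>\<^sup>+\<omega>. ennreal (E t \<omega>) \<partial>M) = (\<integral>\<^sup>+\<omega>. \<integral>\<^sup>+r. indicator {..t} (R r \<omega>) * indicator {0<..} r \<partial>lborel \<partial>M)"
    by (rule nn_integral_cong_AE, use E_occupation[of t] in eventually_elim) simp
  also have "\<dots> = (\<integral>\<^sup>+r. \<integral>\<^sup>+\<omega>. indicator {..t} (R r \<omega>) * indicator {0<..} r \<partial>M \<partial>lborel)"
    by (rule LM.Fubini') measurable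
  also have "\<dots> = (\<integral>\<^sup>+r. (\<integral>\<^sup>+\<omega>. indicator {..t} (R r \<omega>) \<partial>M) * indicator {0<..} r \<partial>lborel)"
    by (intro nn_integral_cong nn_integral_multc) measurable
  also have "\<dots> = ennreal (renewal t)"
    using nn_integral_potential[of "indicator {..t}"] nn_integral_potential_density[OF assms] by simp
  finally show ?thesis .
qed


text \<open>
  Given $S_a$, the time after $a$ that $S$ spends below $t$ has mean \<open>renewal (t - S\<^sub>a)\<close>.
\<close>

lemma nn_integral_cross:
  assumes "s \<le> t" "0 \<le> s"
  shows "(\<integral>\<^sup>+a. \<integral>\<^sup>+b. (\<integral>\<^sup>+\<omega>. indicator {..s} (R a \<omega>) * indicator {..t} (R b \<omega>) \<partial>M)
           * indicator {a<..} b * indicator {0<..} a \<partial>lborel \<partial>lborel) = cross s t"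
proof -
  interpret LM: pair_sigma_finite lborel M ..
  define q where "q a b = (\<integral>\<^sup>+\<omega>. indicator {..s} (R a \<omega>) * indicator {..t} (R b \<omega>) \<partial>M)" for a b :: real
  have "(\<lambda>b. q a b) \<in> borel_measurable lborel" for a
    unfolding q_def by measurable
  then have q[measurable]: "(\<lambda>b. q a b) \<in> borel_measurable borel" for a
    by simp
  have inner: "(\<integral>\<^sup>+b. q a b * indicator {a<..} b \<partial>lborel)
      = (\<integral>\<^sup>+\<omega>. indicator {..s} (R a \<omega>) * ennreal (renewal (t - R a \<omega>)) \<partial>M)" if a: "a > 0" for a
  proof -
    \<comment> \<open>The Markov property at time a: S_(a+c) is S_a plus an independent copy of S_c,
      so the second constraint becomes a bound on that copy.\<close>
    have qac: "q a (a + c) = (\<integral>\<^sup>+\<omega>. indicator {..s} (R a \<omega>) * (\<integral>\<^sup>+\<omega>'. indicator {..t - R a \<omega>} (R c \<omega>') \<partial>M) \<partial>M)"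
      if c: "c > 0" for c
    proof -
      have "q a (a + c) = (\<integral>\<^sup>+\<omega>. indicator {..s} (S a \<omega>) * indicator {..t} (S a \<omega> + (S (a + c) \<omega> - S a \<omega>)) \<partial>M)"
        unfolding q_def
        by (rule nn_integral_cong_AE, use R_eq in eventually_elim) (use a c in simp)
      also have "\<dots> = (\<integral>\<^sup>+\<omega>. \<integral>\<^sup>+\<omega>'. indicator {..s} (S a \<omega>) * indicator {..t} (S a \<omega> + S (a + c - a) \<omega>') \<partial>M \<partial>M)"
        by (rule levy_process_nn_integral_increment[OF subordinator_levy[OF stable]]) (use a c in simp_all)
      also have "\<dots> = (\<integral>\<^sup>+\<omega>. indicator {..s} (R a \<omega>) * (\<integral>\<^sup>+\<omega>'. indicator {..t - R a \<omega>} (R c \<omega>') \<partial>M) \<partial>M)"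
      proof (rule nn_integral_cong_AE, use R_eq in eventually_elim)
        case (elim \<omega>)
        have "(\<integral>\<^sup>+\<omega>'. indicator {..s} (S a \<omega>) * indicator {..t} (S a \<omega> + S (a + c - a) \<omega>') \<partial>M)
            = (\<integral>\<^sup>+\<omega>'. indicator {..s} (R a \<omega>) * indicator {..t - R a \<omega>} (R c \<omega>') \<partial>M)"
          by (rule nn_integral_cong_AE, use R_eq in eventually_elim)
             (use a c elim in \<open>auto simp: indicator_def algebra_simps\<close>)
        also have "\<dots> = indicator {..s} (R a \<omega>) * (\<integral>\<^sup>+\<omega>'. indicator {..t - R a \<omega>} (R c \<omega>') \<partial>M)"
          by (rule nn_integral_cmult) measurable
        finally show ?case .
      qed
      finally show ?thesis .
    qed
    have "(\<integral>\<^sup>+b. q a b * indicator {a<..} b \<partial>lborel) = (\<integral>\<^sup>+c. q a (a + c) * indicator {0<..} c \<partial>lborel)"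
      using nn_integral_real_affine[of "\<lambda>b. q a b * indicator {a<..} b" 1 a] q
      by (simp add: indicator_def)
    also have "\<dots> = (\<integral>\<^sup>+c. \<integral>\<^sup>+\<omega>. indicator {..s} (R a \<omega>) *
        (\<integral>\<^sup>+\<omega>'. indicator {..t - R a \<omega>} (R c \<omega>') \<partial>M) * indicator {0<..} c \<partial>M \<partial>lborel)"
    proof (rule nn_integral_cong)
      fix c :: real
      show "q a (a + c) * indicator {0<..} c = (\<integral>\<^sup>+\<omega>. indicator {..s} (R a \<omega>) *
        (\<integral>\<^sup>+\<omega>'. indicator {..t - R a \<omega>} (R c \<omega>') \<partial>M) * indicator {0<..} c \<partial>M)"
        by (cases "c > 0") (simp_all add: qac indicator_def)
    qed
    also have "\<dots> = (\<integral>\<^sup>+\<omega>. \<integral>\<^sup>+c. indicator {..s} (R a \<omega>) *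
        (\<integral>\<^sup>+\<omega>'. indicator {..t - R a \<omega>} (R c \<omega>') \<partial>M) * indicator {0<..} c \<partial>lborel \<partial>M)"
      by (rule LM.Fubini'[symmetric]) (simp only: indicator_def atMost_iff greaterThan_iff, measurable)
    also have "\<dots> = (\<integral>\<^sup>+\<omega>. indicator {..s} (R a \<omega>) * ennreal (renewal (t - R a \<omega>)) \<partial>M)"
    proof (rule nn_integral_cong)
      fix \<omega>
      have "(\<integral>\<^sup>+c. indicator {..s} (R a \<omega>) *
          (\<integral>\<^sup>+\<omega>'. indicator {..t - R a \<omega>} (R c \<omega>') \<partial>M) * indicator {0<..} c \<partial>lborel)
        = indicator {..s} (R a \<omega>) *
          (\<integral>\<^sup>+c. (\<integral>\<^sup>+\<omega>'. indicator {..t - R a \<omega>} (R c \<omega>') \<partial>M) * indicator {0<..} c \<partial>lborel)"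
        by (simp add: indicator_def)
      \<comment> \<open>If \<open>R a \<omega> \<le> s\<close>, then \<open>t - R a \<omega>\<close>
        is nonnegative, as the renewal formula requires; otherwise both sides are 0.\<close>
      also have "\<dots> = indicator {..s} (R a \<omega>) * ennreal (renewal (t - R a \<omega>))"
        using nn_integral_potential[of "indicator {..t - R a \<omega>}"] nn_integral_potential_density[of "t - R a \<omega>"] assms
        by (cases "R a \<omega> \<le> s") simp_all
      finally show "(\<integral>\<^sup>+c. indicator {..s} (R a \<omega>) *
          (\<integral>\<^sup>+\<omega>'. indicator {..t - R a \<omega>} (R c \<omega>') \<partial>M) * indicator {0<..} c \<partial>lborel)
        = indicator {..s} (R a \<omega>) * ennreal (renewal (t - R a \<omega>))" .
    qed
    finally show ?thesis .
  qed
  have "(\<integral>\<^sup>+a. \<integral>\<^sup>+b. q a b * indicator {a<..} b * indicator {0<..} a \<partial>lborel \<partial>lborel)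
      = (\<integral>\<^sup>+a. (\<integral>\<^sup>+\<omega>. indicator {..s} (R a \<omega>) * ennreal (renewal (t - R a \<omega>)) \<partial>M) * indicator {0<..} a \<partial>lborel)"
  proof (rule nn_integral_cong)
    fix a :: real
    show "(\<integral>\<^sup>+b. q a b * indicator {a<..} b * indicator {0<..} a \<partial>lborel)
        = (\<integral>\<^sup>+\<omega>. indicator {..s} (R a \<omega>) * ennreal (renewal (t - R a \<omega>)) \<partial>M) * indicator {0<..} a"
      using inner[of a] by (cases "a > 0") simp_all
  qed
  also have "\<dots> = cross s t"
    unfolding cross_def
    using nn_integral_potential[of "\<lambda>x. indicator {..s} x * ennreal (renewal (t - x))"] by simp
  finally show ?thesis by (simp add: q_def)
qed

text \<open>The product is a double occupation integral over times a and b, split along the null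
  diagonal. The part a < b is \<open>cross s t\<close>. For b < a monotonicity gives S_b \<le> S_a
  \<le> s \<le> t, so the bound t may be replaced by s, and exchanging the names of a and b leaves
  \<open>cross s s\<close>.\<close>

lemma nn_integral_E_mult:
  assumes "0 \<le> s" "s \<le> t"
  shows "(\<integral>\<^sup>+\<omega>. ennreal (E s \<omega> * E t \<omega>) \<partial>M) = cross s t + cross s s"
proof -
  interpret LM: pair_sigma_finite lborel M ..
  define q where "q t a b = (\<integral>\<^sup>+\<omega>. indicator {..s} (R a \<omega>) * indicator {..t} (R b \<omega>) \<partial>M)" for t a b :: real
  have q[measurable]: "(\<lambda>(a, b). q t a b) \<in> borel_measurable (lborel \<Otimes>\<^sub>M lborel)" for t
    unfolding q_def by measurable
  define G G' where "G a b = q t a b * indicator {a<..} b * indicator {0<..} a"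
    and "G' a b = q t a b * indicator {b<..} a * indicator {0<..} b" for a b
  have G[measurable]: "(\<lambda>(a, b). G a b) \<in> borel_measurable (lborel \<Otimes>\<^sub>M lborel)"
    "(\<lambda>(a, b). G' a b) \<in> borel_measurable (lborel \<Otimes>\<^sub>M lborel)"
    by (simp_all only: G_def G'_def indicator_def greaterThan_iff, measurable)
  define F :: "real \<Rightarrow> real \<Rightarrow> 'a \<Rightarrow> ennreal" where
    "F t r \<omega> = indicator {..t} (R r \<omega>) * indicator {0<..} r" for t r \<omega>
  have F[measurable]: "(\<lambda>(r, \<omega>). F t r \<omega>) \<in> borel_measurable (lborel \<Otimes>\<^sub>M M)" for t
    unfolding F_def by measurable
  have "(\<integral>\<^sup>+\<omega>. ennreal (E s \<omega> * E t \<omega>) \<partial>M)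
      = (\<integral>\<^sup>+\<omega>. (\<integral>\<^sup>+a. F s a \<omega> \<partial>lborel) * (\<integral>\<^sup>+b. F t b \<omega> \<partial>lborel) \<partial>M)"
    by (rule nn_integral_cong_AE, use E_occupation[of s] E_occupation[of t] E_nonneg in eventually_elim)
       (simp add: ennreal_mult F_def)
  also have "\<dots> = (\<integral>\<^sup>+\<omega>. \<integral>\<^sup>+a. F s a \<omega> * (\<integral>\<^sup>+b. F t b \<omega> \<partial>lborel) \<partial>lborel \<partial>M)"
    by (intro nn_integral_cong nn_integral_multc[symmetric]) measurable
  also have "\<dots> = (\<integral>\<^sup>+a. \<integral>\<^sup>+\<omega>. F s a \<omega> * (\<integral>\<^sup>+b. F t b \<omega> \<partial>lborel) \<partial>M \<partial>lborel)"
    by (rule LM.Fubini') measurable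
  also have "\<dots> = (\<integral>\<^sup>+a. \<integral>\<^sup>+\<omega>. \<integral>\<^sup>+b. F s a \<omega> * F t b \<omega> \<partial>lborel \<partial>M \<partial>lborel)"
    by (intro nn_integral_cong nn_integral_cmult[symmetric]) measurable
  also have "\<dots> = (\<integral>\<^sup>+a. \<integral>\<^sup>+b. \<integral>\<^sup>+\<omega>. F s a \<omega> * F t b \<omega> \<partial>M \<partial>lborel \<partial>lborel)"
    by (intro nn_integral_cong LM.Fubini') measurable
  also have "\<dots> = (\<integral>\<^sup>+a. \<integral>\<^sup>+b. q t a b * indicator {0<..} a * indicator {0<..} b \<partial>lborel \<partial>lborel)"
    unfolding q_def F_def by (intro nn_integral_cong) (simp add: indicator_def)
  also have "\<dots> = (\<integral>\<^sup>+a. \<integral>\<^sup>+b. G a b + G' a b \<partial>lborel \<partial>lborel)"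
  proof (rule nn_integral_cong, rule nn_integral_cong_AE)
    fix a :: real
    show "AE b in lborel. q t a b * indicator {0<..} a * indicator {0<..} b
        = G a b + G' a b"
      using AE_lborel_singleton[of a] by eventually_elim (auto simp: G_def G'_def indicator_def)
  qed
  also have "\<dots> = (\<integral>\<^sup>+a. (\<integral>\<^sup>+b. G a b \<partial>lborel) +
      (\<integral>\<^sup>+b. G' a b \<partial>lborel) \<partial>lborel)"
    by (intro nn_integral_cong nn_integral_add) measurable
  also have "\<dots> = (\<integral>\<^sup>+a. (\<integral>\<^sup>+b. G a b \<partial>lborel) \<partial>lborel) +
      (\<integral>\<^sup>+a. \<integral>\<^sup>+b. G' a b \<partial>lborel \<partial>lborel)"
    by (rule nn_integral_add) measurable
  also have "(\<integral>\<^sup>+a. (\<integral>\<^sup>+b. G a b \<partial>lborel) \<partial>lborel) = cross s t"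
    using nn_integral_cross[OF assms(2,1)] by (simp add: G_def q_def)
  also have "(\<integral>\<^sup>+a. \<integral>\<^sup>+b. G' a b \<partial>lborel \<partial>lborel)
      = (\<integral>\<^sup>+b. \<integral>\<^sup>+a. G' a b \<partial>lborel \<partial>lborel)"
    by (rule lborel_pair.Fubini'[symmetric]) measurable
  also have "\<dots> = (\<integral>\<^sup>+b. \<integral>\<^sup>+a. q s b a * indicator {b<..} a * indicator {0<..} b \<partial>lborel \<partial>lborel)"
  proof (intro nn_integral_cong)
    fix a b :: real
    show "G' a b = q s b a * indicator {b<..} a * indicator {0<..} b"
    proof (cases "0 < b \<and> b < a")
      case True
      have "q t a b = q s b a"
        unfolding q_def
      proof (rule nn_integral_cong_AE, use S_good in eventually_elim)
        case (elim \<omega>)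
        then have "R b \<omega> \<le> R a \<omega>" using True by simp
        then show ?case using assms by (auto simp: indicator_def)
      qed
      then show ?thesis by (simp add: G'_def)
    qed (auto simp: G'_def indicator_def)
  qed
  also have "\<dots> = cross s s"
    using nn_integral_cross[OF order.refl assms(1)] by (simp add: q_def)
  finally show ?thesis .
qed

end

subsection \<open>The fractional Poisson process\<close>

text \<open>The weights satisfy (n+1) p(n+1) = r p(n), so each factor n trades a shift of the series
  for a factor r.\<close>

lemma nn_integral_poisson_pmf:
  assumes r: "r > 0"
  shows "(\<integral>\<^sup>+n. ennreal (real n) \<partial>measure_pmf (poisson_pmf r)) = ennreal r"
    and "(\<integral>\<^sup>+n. ennreal (real n * real n) \<partial>measure_pmf (poisson_pmf r)) = ennreal (r + r\<^sup>2)"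
proof -
  define p where "p n = r ^ n / fact n * exp (- r)" for n
  have p: "p n \<ge> 0" for n using r by (simp add: p_def)
  have Suc: "real (Suc n) * p (Suc n) = r * p n" for n
    by (simp add: p_def fact_Suc del: of_nat_Suc)
  have "(\<lambda>n. r ^ n /\<^sub>R fact n * exp (- r)) sums (exp r * exp (- r))"
    by (rule sums_mult2[OF exp_converges])
  then have s0: "p sums 1"
    unfolding p_def[abs_def] by (simp add: exp_minus divide_inverse mult.commute[of "inverse _"])
  have "(\<lambda>n. real (Suc n) * p (Suc n)) sums r"
    unfolding Suc using sums_mult[OF s0, of r] by simp
  from sums_Suc[OF this] have s1: "(\<lambda>n. real n * p n) sums r"
    by simp
  have "real (Suc n) * real (Suc n) * p (Suc n) = r * (real n * p n + p n)" for n
    unfolding mult.assoc Suc by (simp add: algebra_simps)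
  moreover have "(\<lambda>n. r * (real n * p n + p n)) sums (r * (r + 1))"
    by (intro sums_mult sums_add s0 s1)
  ultimately have "(\<lambda>n. real (Suc n) * real (Suc n) * p (Suc n)) sums (r + r\<^sup>2)"
    by (simp add: power2_eq_square algebra_simps)
  from sums_Suc[where f="\<lambda>n. real n * real n * p n", OF this] have s2: "(\<lambda>n. real n * real n * p n) sums (r + r\<^sup>2)"
    by simp
  have *: "(\<integral>\<^sup>+n. ennreal (g n) \<partial>measure_pmf (poisson_pmf r)) = ennreal c"
    if "(\<lambda>n. g n * p n) sums c" "\<And>n. g n \<ge> 0" for g c
  proof -
    have "pmf (poisson_pmf r) n = p n" for n
      using r by (simp add: p_def)
    then have "ennreal (pmf (poisson_pmf r) n) * ennreal (g n) = ennreal (g n * p n)" for n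
      using that(2) p by (simp add: ennreal_mult mult.commute)
    then have "(\<integral>\<^sup>+n. ennreal (g n) \<partial>measure_pmf (poisson_pmf r)) = (\<Sum>n. ennreal (g n * p n))"
      by (simp only: nn_integral_measure_pmf nn_integral_count_space_nat)
    also have "\<dots> = ennreal c"
      by (rule suminf_ennreal_eq) (use that p in auto)
    finally show ?thesis .
  qed
  show "(\<integral>\<^sup>+n. ennreal (real n) \<partial>measure_pmf (poisson_pmf r)) = ennreal r"
    by (rule *[OF s1]) simp
  show "(\<integral>\<^sup>+n. ennreal (real n * real n) \<partial>measure_pmf (poisson_pmf r)) = ennreal (r + r\<^sup>2)"
    by (rule *[OF s2]) simp
qed

context prob_space
begin

lemma poisson_process_levy: "poisson_process lam N \<Longrightarrow> levy_process N"
  by (simp add: poisson_process_def)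

lemma poisson_process_moments:
  assumes N: "poisson_process lam N" and lam: "lam > 0" and t: "t \<ge> 0"
  shows "AE \<omega> in M. N t \<omega> \<ge> 0"
    and "(\<integral>\<^sup>+\<omega>. ennreal (N t \<omega>) \<partial>M) = ennreal (lam * t)"
    and "(\<integral>\<^sup>+\<omega>. ennreal (N t \<omega> * N t \<omega>) \<partial>M) = ennreal (lam * t + (lam * t)\<^sup>2)"
proof -
  note [measurable] = levy_process_measurable[OF poisson_process_levy[OF N] t]
  have "(AE \<omega> in M. N t \<omega> \<ge> 0) \<and> (\<integral>\<^sup>+\<omega>. ennreal (N t \<omega>) \<partial>M) = ennreal (lam * t) \<and>
    (\<integral>\<^sup>+\<omega>. ennreal (N t \<omega> * N t \<omega>) \<partial>M) = ennreal (lam * t + (lam * t)\<^sup>2)"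
  \<comment> \<open>The law is prescribed for t > 0 only; at time 0 the almost sure value 0 yields
    the same formulas.\<close>
  proof (cases "t = 0")
    case True
    have z: "AE \<omega> in M. N t \<omega> = 0"
      using N True by (simp add: poisson_process_def levy_process_def)
    have "(\<integral>\<^sup>+\<omega>. ennreal (N t \<omega>) \<partial>M) = (\<integral>\<^sup>+\<omega>. 0 \<partial>M)"
      by (rule nn_integral_cong_AE, use z in eventually_elim) simp
    moreover have "(\<integral>\<^sup>+\<omega>. ennreal (N t \<omega> * N t \<omega>) \<partial>M) = (\<integral>\<^sup>+\<omega>. 0 \<partial>M)"
      by (rule nn_integral_cong_AE, use z in eventually_elim) simp
    moreover have "AE \<omega> in M. N t \<omega> \<ge> 0"
      using z by eventually_elim simp
    ultimately show ?thesis using True by simp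
  next
    case False
    then have eq: "distr M borel (N t) = distr (measure_pmf (poisson_pmf (lam * t))) borel real"
      using N t by (simp add: poisson_process_def)
    have g: "(\<integral>\<^sup>+\<omega>. g (N t \<omega>) \<partial>M) = (\<integral>\<^sup>+n. g (real n) \<partial>measure_pmf (poisson_pmf (lam * t)))"
      if [measurable]: "g \<in> borel_measurable borel" for g
    proof -
      have "(\<integral>\<^sup>+\<omega>. g (N t \<omega>) \<partial>M) = (\<integral>\<^sup>+x. g x \<partial>distr M borel (N t))"
        by (simp add: nn_integral_distr)
      then show ?thesis unfolding eq by (simp add: nn_integral_distr)
    qed
    have "AE x in distr M borel (N t). x \<ge> 0"
      unfolding eq by (subst AE_distr_iff) auto
    then have "AE \<omega> in M. N t \<omega> \<ge> 0"
      by (subst (asm) AE_distr_iff) auto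
    moreover have "lam * t > 0" using lam t False by simp
    ultimately show ?thesis
      using g[of ennreal] g[of "\<lambda>x. ennreal (x * x)"] by (simp add: nn_integral_poisson_pmf)
  qed
  then show "AE \<omega> in M. N t \<omega> \<ge> 0"
    and "(\<integral>\<^sup>+\<omega>. ennreal (N t \<omega>) \<partial>M) = ennreal (lam * t)"
    and "(\<integral>\<^sup>+\<omega>. ennreal (N t \<omega> * N t \<omega>) \<partial>M) = ennreal (lam * t + (lam * t)\<^sup>2)"
    by auto
qed

text \<open>Writing N_t as N_s plus an independent increment gives the second moment of N_s plus a
  product of means.\<close>

lemma poisson_process_nn_integral_mult:
  assumes N: "poisson_process lam N" and lam: "lam > 0" and st: "0 \<le> s" "s \<le> t"
  shows "(\<integral>\<^sup>+\<omega>. ennreal (N s \<omega> * N t \<omega>) \<partial>M) = ennreal (lam * s + lam\<^sup>2 * (s * t))"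
proof -
  have d: "0 \<le> t - s" using st by simp
  note L = poisson_process_levy[OF N]
  note [measurable] = levy_process_measurable[OF L st(1)] levy_process_measurable[OF L d]
  note Ms = poisson_process_moments[OF N lam st(1)] and Md = poisson_process_moments[OF N lam d]
  have "(\<integral>\<^sup>+\<omega>. ennreal (N s \<omega> * N t \<omega>) \<partial>M) = (\<integral>\<^sup>+\<omega>. ennreal (N s \<omega> * (N s \<omega> + (N t \<omega> - N s \<omega>))) \<partial>M)"
    by simp
  also have "\<dots> = (\<integral>\<^sup>+\<omega>. \<integral>\<^sup>+\<omega>'. ennreal (N s \<omega> * (N s \<omega> + N (t - s) \<omega>')) \<partial>M \<partial>M)"
    by (rule levy_process_nn_integral_increment[OF L st]) measurable
  also have "\<dots> = (\<integral>\<^sup>+\<omega>. ennreal (N s \<omega> * N s \<omega>) + ennreal (N s \<omega>) * ennreal (lam * (t - s)) \<partial>M)"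
  proof (rule nn_integral_cong_AE, use Ms(1) in eventually_elim)
    case (elim \<omega>)
    have "(\<integral>\<^sup>+\<omega>'. ennreal (N s \<omega> * (N s \<omega> + N (t - s) \<omega>')) \<partial>M)
        = (\<integral>\<^sup>+\<omega>'. ennreal (N s \<omega> * N s \<omega>) + ennreal (N s \<omega>) * ennreal (N (t - s) \<omega>') \<partial>M)"
      by (rule nn_integral_cong_AE, use Md(1) in eventually_elim)
         (use elim in \<open>simp add: distrib_left ennreal_mult ennreal_plus\<close>)
    also have "\<dots> = ennreal (N s \<omega> * N s \<omega>) + ennreal (N s \<omega>) * ennreal (lam * (t - s))"
      by (simp add: nn_integral_add nn_integral_cmult Md(2) emeasure_space_1)
    finally show ?case .
  qed
  also have "\<dots> = ennreal (lam * s + (lam * s)\<^sup>2) + ennreal (lam * s) * ennreal (lam * (t - s))"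
    by (simp add: nn_integral_add nn_integral_multc Ms)
  also have "\<dots> = ennreal (lam * s + (lam * s)\<^sup>2 + lam * s * (lam * (t - s)))"
  proof -
    have nn: "0 \<le> lam * s" "0 \<le> lam * (t - s)" using lam st by simp_all
    show ?thesis
      by (simp only: ennreal_mult[OF nn] ennreal_plus[OF add_nonneg_nonneg[OF nn(1) zero_le_power2] mult_nonneg_nonneg[OF nn]])
  qed
  also have "lam * s + (lam * s)\<^sup>2 + lam * s * (lam * (t - s)) = lam * s + lam\<^sup>2 * (s * t)"
    by (simp add: power2_eq_square algebra_simps)
  finally show ?thesis .
qed

text \<open>Source of the measurability of the inverse process at fixed times: coordinates of a
  measurable path-valued map are measurable.\<close>

lemma indep_processes_measurable:
  assumes "indep_processes X Y" "t \<ge> 0"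
  shows "random_variable borel (X t)" "random_variable borel (Y t)"
proof -
  have 1: "random_variable (PiM {0..} (\<lambda>_. borel)) (\<lambda>\<omega>. \<lambda>t\<in>{0..}. X t \<omega>)"
    and 2: "random_variable (PiM {0..} (\<lambda>_. borel)) (\<lambda>\<omega>. \<lambda>t\<in>{0..}. Y t \<omega>)"
    using assms(1) by (auto simp: indep_processes_def indep_var_distribution_eq)
  have "(\<lambda>\<omega>. (\<lambda>t\<in>{0..}. X t \<omega>) t) \<in> borel_measurable M" "(\<lambda>\<omega>. (\<lambda>t\<in>{0..}. Y t \<omega>) t) \<in> borel_measurable M"
    using measurable_compose[OF 1 measurable_component_singleton] measurable_compose[OF 2 measurable_component_singleton]
      assms(2) by (simp_all del: restrict_apply restrict_apply')
  then show "random_variable borel (X t)" "random_variable borel (Y t)"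
    using assms(2) by simp_all
qed

end

section \<open>Bounds and scaling of the cross term\<close>

context stable_subordinator
begin

lemma renewal_mono: "0 \<le> s \<Longrightarrow> s \<le> t \<Longrightarrow> renewal s \<le> renewal t"
  using pos Gamma_real_pos[of "1 + \<beta>"] by (simp add: renewal_def powr_mono2 divide_right_mono)

lemma renewal_scale: "0 \<le> s \<Longrightarrow> 0 \<le> t \<Longrightarrow> renewal (s * t) = s powr \<beta> * renewal t"
  by (simp add: renewal_def powr_mult)

text \<open>For 0 < x \<le> s monotonicity puts \<open>renewal (t - x)\<close> between
  \<open>renewal (t - s)\<close> and \<open>renewal t\<close>, and the remaining integral of the
  density over [0,s] is \<open>renewal s\<close>. The gap between the two bounds closes as t grows,
  because \<beta> < 1.\<close>

lemma cross_bounds: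
  assumes "0 \<le> s" "s \<le> t"
  shows "cross s t \<le> ennreal (renewal s * renewal t)"
    and "ennreal (renewal s * renewal (t - s)) \<le> cross s t"
proof -
  have I: "(\<integral>\<^sup>+x. ennreal (renewal u) * (indicator {..s} x * potential_density x) \<partial>lborel)
      = ennreal (renewal s * renewal u)" for u
    using nn_integral_potential_density[OF assms(1)]
    by (simp add: nn_integral_cmult ennreal_mult mult.commute)
  have "indicator {..s} x * ennreal (renewal (t - x)) * potential_density x
      \<le> ennreal (renewal t) * (indicator {..s} x * potential_density x)" for x
  proof (cases "0 < x \<and> x \<le> s")
    case True
    then have "renewal (t - x) \<le> renewal t" using assms by (intro renewal_mono) auto
    with True show ?thesis by (simp add: mult_right_mono ennreal_leI)
  qed (auto simp: potential_density_def indicator_def)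
  then show "cross s t \<le> ennreal (renewal s * renewal t)"
    unfolding cross_def I[symmetric] by (rule nn_integral_mono)
  have "ennreal (renewal (t - s)) * (indicator {..s} x * potential_density x)
      \<le> indicator {..s} x * ennreal (renewal (t - x)) * potential_density x" for x
  proof (cases "0 < x \<and> x \<le> s")
    case True
    then have "renewal (t - s) \<le> renewal (t - x)" using assms by (intro renewal_mono) auto
    with True show ?thesis by (simp add: mult_right_mono ennreal_leI)
  qed (auto simp: potential_density_def indicator_def)
  then show "ennreal (renewal s * renewal (t - s)) \<le> cross s t"
    unfolding cross_def I[symmetric] by (rule nn_integral_mono)
qed

text \<open>Self-similarity: substituting s x, the differential contributes s, the renewal function
  s^\<beta> and the density s^(\<beta>-1).\<close>

lemma cross_diag:
  assumes "s \<ge> 0"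
  shows "cross s s = ennreal (s powr (2 * \<beta>)) * cross 1 1"
proof (cases "s = 0")
  case True
  have "cross 0 0 = (\<integral>\<^sup>+x. 0 \<partial>(lborel :: real measure))"
    unfolding cross_def by (intro nn_integral_cong) (auto simp: potential_density_def indicator_def)
  with True show ?thesis by simp
next
  case False
  with assms have s: "s > 0" by simp
  have "cross s s = ennreal s * (\<integral>\<^sup>+x. indicator {..s} (0 + s * x) * ennreal (renewal (s - (0 + s * x))) *
      potential_density (0 + s * x) \<partial>lborel)"
    unfolding cross_def using s by (subst nn_integral_real_affine[of _ s 0]) simp_all
  also have "(\<integral>\<^sup>+x. indicator {..s} (0 + s * x) * ennreal (renewal (s - (0 + s * x))) *
      potential_density (0 + s * x) \<partial>lborel)
    = (\<integral>\<^sup>+x. ennreal (s powr \<beta> * s powr (\<beta> - 1)) * (indicator {..1} x * ennreal (renewal (1 - x)) *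
      potential_density x) \<partial>lborel)"
  proof (rule nn_integral_cong)
    fix x :: real
    show "indicator {..s} (0 + s * x) * ennreal (renewal (s - (0 + s * x))) * potential_density (0 + s * x)
      = ennreal (s powr \<beta> * s powr (\<beta> - 1)) * (indicator {..1} x * ennreal (renewal (1 - x)) * potential_density x)"
    proof (cases "0 < x \<and> x \<le> 1")
      case True
      have "renewal (s - s * x) = s powr \<beta> * renewal (1 - x)"
        using renewal_scale[of s "1 - x"] s True by (simp add: right_diff_distrib)
      then show ?thesis
        using s True Gamma_real_pos[OF pos]
        by (simp add: potential_density_def powr_mult ennreal_mult divide_inverse mult_ac)
    next
      case False
      then show ?thesis using s
        by (auto simp: potential_density_def indicator_def zero_less_mult_iff)
    qed
  qed
  also have "\<dots> = ennreal (s powr \<beta> * s powr (\<beta> - 1)) * cross 1 1"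
    unfolding cross_def by (rule nn_integral_cmult) measurable
  also have "ennreal s * (ennreal (s powr \<beta> * s powr (\<beta> - 1)) * cross 1 1)
      = ennreal (s * (s powr \<beta> * s powr (\<beta> - 1))) * cross 1 1"
    using s by (simp add: ennreal_mult mult.assoc)
  also have "s * (s powr \<beta> * s powr (\<beta> - 1)) = s powr (2 * \<beta>)"
  proof -
    have "s * (s powr \<beta> * s powr (\<beta> - 1)) = s powr 1 * (s powr \<beta> * s powr (\<beta> - 1))"
      using s by simp
    also have "\<dots> = s powr (1 + (\<beta> + (\<beta> - 1)))"
      by (simp only: powr_add)
    finally show ?thesis by simp
  qed
  finally show ?thesis .
qed

text \<open>
  Since $(1-x)^\beta \ge 1-x$ on the unit interval, this follows from
  $\int_0^1 (1-x)\,\beta x^{\beta-1}\,dx = 1/(1+\beta)$.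
\<close>

lemma cross_one_ge: "ennreal ((renewal 1)\<^sup>2 / (1 + \<beta>)) \<le> cross 1 1"
proof -
  have G: "Gamma \<beta> > 0" using pos by (rule Gamma_real_pos)
  have "\<beta> \<notin> \<int>\<^sub>\<le>\<^sub>0" using pos nonpos_Ints_nonpos[of \<beta>] by auto
  then have r1: "renewal 1 = 1 / (\<beta> * Gamma \<beta>)"
    using Gamma_plus1[of \<beta>] by (simp add: renewal_def add.commute)
  have 1: "((\<lambda>x. x powr (\<beta> - 1)) has_integral (1 powr (\<beta> - 1 + 1) / (\<beta> - 1 + 1))) {0..1}"
    and 2: "((\<lambda>x. x powr \<beta>) has_integral (1 powr (\<beta> + 1) / (\<beta> + 1))) {0..1}"
    using pos by (intro has_integral_powr_from_0; simp)+
  have "((\<lambda>x. renewal 1 / Gamma \<beta> * (x powr (\<beta> - 1) - x powr \<beta>)) has_integral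
      (renewal 1 / Gamma \<beta> * (1 powr (\<beta> - 1 + 1) / (\<beta> - 1 + 1) - 1 powr (\<beta> + 1) / (\<beta> + 1)))) {0..1}"
    by (intro has_integral_mult_right has_integral_diff 1 2)
  \<comment> \<open>Here 1/\<beta> - 1/(1+\<beta>) = 1/(\<beta>(1+\<beta>)), and the factor
    1/(\<beta> Gamma(\<beta>)) is a second copy of \<open>renewal 1\<close>.\<close>
  moreover have "renewal 1 / Gamma \<beta> * (1 powr (\<beta> - 1 + 1) / (\<beta> - 1 + 1) - 1 powr (\<beta> + 1) / (\<beta> + 1))
      = (renewal 1)\<^sup>2 / (1 + \<beta>)"
    using pos G by (simp add: r1 power2_eq_square field_simps)
  ultimately have I: "((\<lambda>x. renewal 1 / Gamma \<beta> * (x powr (\<beta> - 1) - x powr \<beta>)) has_integral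
      ((renewal 1)\<^sup>2 / (1 + \<beta>))) {0..1}"
    by simp
  have val: "(\<integral>\<^sup>+x. ennreal (renewal 1 / Gamma \<beta> * (x powr (\<beta> - 1) - x powr \<beta>)) * indicator {0..1} x \<partial>lborel)
      = ennreal ((renewal 1)\<^sup>2 / (1 + \<beta>))"
  proof (rule nn_integral_has_integral_lebesgue'[OF _ I])
    fix x :: real assume "x \<in> {0..1}"
    \<comment> \<open>At x = 0 both powers are 0 by the convention for \<open>powr\<close>.\<close>
    then have "x powr \<beta> \<le> x powr (\<beta> - 1)"
      by (cases "x = 0") (auto intro!: powr_mono')
    then show "0 \<le> renewal 1 / Gamma \<beta> * (x powr (\<beta> - 1) - x powr \<beta>)"
      using G by simp
  qed
  have "(\<integral>\<^sup>+x. ennreal (renewal 1 / Gamma \<beta> * (x powr (\<beta> - 1) - x powr \<beta>)) * indicator {0..1} x \<partial>lborel)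
      \<le> cross 1 1"
    unfolding cross_def
  proof (rule nn_integral_mono)
    fix x :: real
    show "ennreal (renewal 1 / Gamma \<beta> * (x powr (\<beta> - 1) - x powr \<beta>)) * indicator {0..1} x
      \<le> indicator {..1} x * ennreal (renewal (1 - x)) * potential_density x"
    proof (cases "0 < x \<and> x \<le> 1")
      case True
      have "x powr (\<beta> - 1) * x = x powr \<beta>"
        using True by (simp add: powr_diff)
      then have "renewal 1 / Gamma \<beta> * (x powr (\<beta> - 1) - x powr \<beta>) = renewal 1 * (1 - x) * (x powr (\<beta> - 1) / Gamma \<beta>)"
        by (simp add: field_simps)
      also have "\<dots> \<le> renewal (1 - x) * (x powr (\<beta> - 1) / Gamma \<beta>)"
      proof (intro mult_right_mono)
        have "(1 - x) powr 1 \<le> (1 - x) powr \<beta>"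
          using True less_one by (intro powr_mono') auto
        then have "renewal 1 * (1 - x) \<le> renewal 1 * (1 - x) powr \<beta>"
          using True by (intro mult_left_mono) auto
        then show "renewal 1 * (1 - x) \<le> renewal (1 - x)"
          using renewal_scale[of "1 - x" 1] True by (simp add: mult.commute)
      qed (use G in simp)
      finally show ?thesis
        using True G by (simp add: potential_density_def ennreal_leI flip: ennreal_mult)
    next
      case False
      then show ?thesis by (cases "x = 0") (auto simp: indicator_def)
    qed
  qed
  then show ?thesis unfolding val .
qed

end

text \<open>The interface to the main proof: conditioning on the inverse subordinator turns the
  Poisson moments into moments of \<open>E\<close>. Right-continuity and nonnegativity of X are
  included because X is in turn evaluated at the random times D.\<close>

lemma (in prob_space) fractional_poisson_process_moments:
  assumes \<beta>: "0 < \<beta>" "\<beta> < 1" and lam: "lam > 0"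
    and X: "fractional_poisson_process \<beta> lam X"
  obtains q k H where "q > 0" "k > 1 / 2"
    "AE \<omega> in M. \<forall>t\<ge>0. ((\<lambda>u. X u \<omega>) \<longlongrightarrow> X t \<omega>) (at_right t)"
    "\<And>t. t \<ge> 0 \<Longrightarrow> AE \<omega> in M. X t \<omega> \<ge> 0"
    "\<And>t. t \<ge> 0 \<Longrightarrow> (\<integral>\<^sup>+\<omega>. ennreal (X t \<omega>) \<partial>M) = ennreal (q * t powr \<beta>)"
    "\<And>s t. 0 \<le> s \<Longrightarrow> s \<le> t \<Longrightarrow> (\<integral>\<^sup>+\<omega>. ennreal (X s \<omega> * X t \<omega>) \<partial>M)
       = ennreal (q * s powr \<beta> + q\<^sup>2 * (k * s powr (2 * \<beta>) + H s t))"
    "\<And>s t. 0 \<le> s \<Longrightarrow> s \<le> t \<Longrightarrow> s powr \<beta> * (t - s) powr \<beta> \<le> H s t"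
    "\<And>s t. 0 \<le> s \<Longrightarrow> s \<le> t \<Longrightarrow> H s t \<le> s powr \<beta> * t powr \<beta>"
    "\<And>t. 0 \<le> t \<Longrightarrow> H t t = k * t powr (2 * \<beta>)"
    "case_prod H \<in> borel_measurable (borel \<Otimes>\<^sub>M borel)"
proof -
  from X \<beta> obtain N S where N: "poisson_process lam N" and S: "subordinator (\<lambda>s. s powr \<beta>) S"
    and ind: "indep_processes N (inverse_process S)"
    and XN: "AE \<omega> in M. \<forall>t\<ge>0. X t \<omega> = N (inverse_process S t \<omega>) \<omega>"
    by (auto simp: fractional_poisson_process_def)
  interpret S: stable_subordinator M \<beta> S
    by unfold_locales (use \<beta> S in auto)
  note [measurable] = indep_processes_measurable(2)[OF ind]
  note rcN = levy_process_right_continuous[OF poisson_process_levy[OF N]]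
  have E0: "AE \<omega> in M. \<forall>t\<ge>0. inverse_process S t \<omega> \<ge> 0"
    using S.E_nonneg by eventually_elim simp
  have tc: "(\<integral>\<^sup>+\<omega>. h (X s \<omega>) (X t \<omega>) \<partial>M)
      = (\<integral>\<^sup>+\<omega>. \<integral>\<^sup>+\<omega>'. h (N (S.E s \<omega>) \<omega>') (N (S.E t \<omega>) \<omega>') \<partial>M \<partial>M)"
    if "0 \<le> s" "0 \<le> t" and h: "case_prod h \<in> borel_measurable (borel \<Otimes>\<^sub>M borel)"
    for s t and h :: "real \<Rightarrow> real \<Rightarrow> ennreal"
  proof -
    have "(\<integral>\<^sup>+\<omega>. h (X s \<omega>) (X t \<omega>) \<partial>M) = (\<integral>\<^sup>+\<omega>. h (N (S.E s \<omega>) \<omega>) (N (S.E t \<omega>) \<omega>) \<partial>M)"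
      by (rule nn_integral_cong_AE, use XN in eventually_elim) (use that in simp)
    also have "\<dots> = (\<integral>\<^sup>+\<omega>. \<integral>\<^sup>+\<omega>'. h (N (S.E s \<omega>) \<omega>') (N (S.E t \<omega>) \<omega>') \<partial>M \<partial>M)"
      by (rule nn_integral_time_change[OF ind rcN E0 h that(1,2)])
    finally show ?thesis .
  qed
  define g where "g = S.renewal 1"
  have g: "g > 0"
    using Gamma_real_pos[of "1 + \<beta>"] \<beta> by (simp add: g_def S.renewal_def)
  have ren: "S.renewal t = g * t powr \<beta>" for t
    by (simp add: g_def S.renewal_def)
  define q where "q = lam * g"
  \<comment> \<open>Dividing by g^2 = \<open>(renewal 1)\<close>^2 frees the bounds on H of
    constants; \<open>cross_bounds\<close> ensures that \<open>enn2real\<close> is applied to finite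
    values.\<close>
  define H where "H s t = enn2real (S.cross s t) / g\<^sup>2" for s t
  define k where "k = H 1 1"
  have cross: "S.cross s t = ennreal (g\<^sup>2 * H s t)" if "0 \<le> s" "s \<le> t" for s t
  proof -
    have "S.cross s t < top"
      using S.cross_bounds(1)[OF that] by (rule le_less_trans) simp
    then show ?thesis using g by (simp add: H_def)
  qed
  have H_nonneg: "H s t \<ge> 0" for s t by (simp add: H_def)
  have "k \<ge> 1 / (1 + \<beta>)"
  proof -
    have "ennreal (g\<^sup>2 / (1 + \<beta>)) \<le> ennreal (g\<^sup>2 * k)"
      using S.cross_one_ge cross[of 1 1] by (simp add: k_def g_def)
    then have "g\<^sup>2 / (1 + \<beta>) \<le> g\<^sup>2 * k"
      using H_nonneg by (subst (asm) ennreal_le_iff) (simp_all add: k_def)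
    then have "g\<^sup>2 * (1 / (1 + \<beta>)) \<le> g\<^sup>2 * k" by simp
    then show ?thesis
      by (rule mult_left_le_imp_le) (use g in simp)
  qed
  \<comment> \<open>This is where \<beta> < 1 makes the bound on k strict.\<close>
  moreover have "1 / (1 + \<beta>) > 1 / 2" using \<beta> by (simp add: field_simps)
  ultimately have k: "k > 1 / 2" by linarith
  show ?thesis
  proof (rule that[of q k H])
    show "q > 0" using lam g by (simp add: q_def)
    show "k > 1 / 2" by (rule k)
    show "AE \<omega> in M. \<forall>t\<ge>0. ((\<lambda>u. X u \<omega>) \<longlongrightarrow> X t \<omega>) (at_right t)"
      using XN rcN S.S_good
    proof eventually_elim
      case (elim \<omega>)
      show ?case
      proof (intro allI impI)
        fix t :: real assume t: "t \<ge> 0"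
        have "((\<lambda>u. N (S.E u \<omega>) \<omega>) \<longlongrightarrow> N (S.E t \<omega>) \<omega>) (at_right t)"
          by (rule right_continuous_time_change) (use elim in blast)+
        moreover have "\<forall>\<^sub>F u in at_right t. X u \<omega> = N (S.E u \<omega>) \<omega>"
          using eventually_at_right_less[of t] by eventually_elim (use elim t in simp)
        ultimately show "((\<lambda>u. X u \<omega>) \<longlongrightarrow> X t \<omega>) (at_right t)"
          using elim(1) t by (simp add: tendsto_cong)
      qed
    qed
    show "AE \<omega> in M. X t \<omega> \<ge> 0" if t: "t \<ge> 0" for t
    proof (rule time_change_nonneg[OF ind rcN E0 poisson_process_moments(1)[OF N lam] _ _ t])
      show "random_variable borel (X t)"
        using X \<beta> t by (simp add: fractional_poisson_process_def)
      show "AE \<omega> in M. X t \<omega> = N (S.E t \<omega>) \<omega>"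
        using XN by eventually_elim (use t in simp)
    qed
    show "(\<integral>\<^sup>+\<omega>. ennreal (X t \<omega>) \<partial>M) = ennreal (q * t powr \<beta>)" if t: "t \<ge> 0" for t
    proof -
      have "(\<integral>\<^sup>+\<omega>. ennreal (X t \<omega>) \<partial>M) = (\<integral>\<^sup>+\<omega>. \<integral>\<^sup>+\<omega>'. ennreal (N (S.E t \<omega>) \<omega>') \<partial>M \<partial>M)"
        by (rule tc[of t t "\<lambda>x y. ennreal x", OF t t]) measurable
      also have "\<dots> = (\<integral>\<^sup>+\<omega>. ennreal lam * ennreal (S.E t \<omega>) \<partial>M)"
        by (rule nn_integral_cong_AE, use E0 in eventually_elim)
           (use t lam in \<open>simp add: poisson_process_moments(2)[OF N lam] ennreal_mult\<close>)
      also have "\<dots> = ennreal lam * ennreal (S.renewal t)"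
        using S.nn_integral_E[OF t] t by (simp add: nn_integral_cmult)
      also have "\<dots> = ennreal (q * t powr \<beta>)"
        using lam g by (simp add: q_def ren mult.assoc flip: ennreal_mult)
      finally show ?thesis .
    qed
    show "(\<integral>\<^sup>+\<omega>. ennreal (X s \<omega> * X t \<omega>) \<partial>M)
       = ennreal (q * s powr \<beta> + q\<^sup>2 * (k * s powr (2 * \<beta>) + H s t))" if st: "0 \<le> s" "s \<le> t" for s t
    proof -
      have t: "0 \<le> t" using st by simp
      note [measurable] = indep_processes_measurable(2)[OF ind st(1)] indep_processes_measurable(2)[OF ind t]
      have "(\<integral>\<^sup>+\<omega>. ennreal (X s \<omega> * X t \<omega>) \<partial>M)
          = (\<integral>\<^sup>+\<omega>. \<integral>\<^sup>+\<omega>'. ennreal (N (S.E s \<omega>) \<omega>' * N (S.E t \<omega>) \<omega>') \<partial>M \<partial>M)"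
        by (rule tc[OF st(1) t]) measurable
      also have "\<dots> = (\<integral>\<^sup>+\<omega>. ennreal lam * ennreal (S.E s \<omega>) + ennreal (lam\<^sup>2) * ennreal (S.E s \<omega> * S.E t \<omega>) \<partial>M)"
      proof (rule nn_integral_cong_AE, use S.S_good in eventually_elim)
        case (elim \<omega>)
        have le: "0 \<le> S.E s \<omega>" "S.E s \<omega> \<le> S.E t \<omega>"
          using inverse_process_nonneg[of S \<omega> s] inverse_process_mono[of S \<omega> s t] elim st by blast+
        from poisson_process_nn_integral_mult[OF N lam this] le lam show ?case
          by (simp add: ennreal_plus ennreal_mult)
      qed
      also have "\<dots> = ennreal lam * ennreal (S.renewal s) + ennreal (lam\<^sup>2) * (S.cross s t + S.cross s s)"
        using S.nn_integral_E[OF st(1)] S.nn_integral_E_mult[OF st] by (simp add: nn_integral_add nn_integral_cmult)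
      also have "S.cross s s = ennreal (g\<^sup>2 * (k * s powr (2 * \<beta>)))"
        using S.cross_diag[OF st(1)] cross[of 1 1] g H_nonneg
        by (simp add: k_def mult_ac flip: ennreal_mult)
      also have "S.cross s t = ennreal (g\<^sup>2 * H s t)"
        by (rule cross[OF st])
      also have "ennreal lam * ennreal (S.renewal s) +
          ennreal (lam\<^sup>2) * (ennreal (g\<^sup>2 * H s t) + ennreal (g\<^sup>2 * (k * s powr (2 * \<beta>))))
        = ennreal (lam * S.renewal s + lam\<^sup>2 * (g\<^sup>2 * H s t + g\<^sup>2 * (k * s powr (2 * \<beta>))))"
        using lam k H_nonneg by (simp flip: ennreal_mult ennreal_plus)
      also have "lam * S.renewal s + lam\<^sup>2 * (g\<^sup>2 * H s t + g\<^sup>2 * (k * s powr (2 * \<beta>)))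
        = q * s powr \<beta> + q\<^sup>2 * (k * s powr (2 * \<beta>) + H s t)"
        by (simp add: q_def ren power_mult_distrib algebra_simps)
      finally show ?thesis .
    qed
    show "s powr \<beta> * (t - s) powr \<beta> \<le> H s t" "H s t \<le> s powr \<beta> * t powr \<beta>" if st: "0 \<le> s" "s \<le> t" for s t
    proof -
      have "g\<^sup>2 * (s powr \<beta> * (t - s) powr \<beta>) \<le> g\<^sup>2 * H s t"
        using S.cross_bounds(2)[OF st] cross[OF st] H_nonneg[of s t] g
        by (simp add: ren power2_eq_square mult_ac)
      moreover have "g\<^sup>2 * H s t \<le> g\<^sup>2 * (s powr \<beta> * t powr \<beta>)"
        using S.cross_bounds(1)[OF st] cross[OF st] g
        by (simp add: ren power2_eq_square mult_ac)
      ultimately show "s powr \<beta> * (t - s) powr \<beta> \<le> H s t" "H s t \<le> s powr \<beta> * t powr \<beta>"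
        using g by simp_all
    qed
    show "H t t = k * t powr (2 * \<beta>)" if "0 \<le> t" for t
      using S.cross_diag[OF that] by (simp add: k_def H_def enn2real_mult)
    show "case_prod H \<in> borel_measurable (borel \<Otimes>\<^sub>M borel)"
      unfolding H_def[abs_def] S.cross_def[abs_def]
      by (simp only: indicator_def atMost_iff, measurable)
  qed
qed

subsection \<open>Powers of a subordinator\<close>

text \<open>With u = y/x both bounds follow from v \<le> v^\<beta> on [0,1], taken at v = 1 - u and
  v = u. The first decays as x grows with y fixed; the second is uniform in x and provides the
  dominating function.\<close>

lemma powr_diff_le:
  fixes x y \<beta> :: real
  assumes \<beta>: "0 < \<beta>" "\<beta> < 1" and xy: "0 \<le> y" "y \<le> x"
  shows "x powr \<beta> - (x - y) powr \<beta> \<le> y * x powr (\<beta> - 1)"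
    and "x powr \<beta> - (x - y) powr \<beta> \<le> y powr \<beta>"
proof -
  have "x powr \<beta> - (x - y) powr \<beta> \<le> y * x powr (\<beta> - 1) \<and> x powr \<beta> - (x - y) powr \<beta> \<le> y powr \<beta>"
  proof (cases "x = 0")
    case True
    with xy show ?thesis by simp
  next
    case False
    with xy have x: "x > 0" by simp
    define u where "u = y / x"
    have u: "0 \<le> u" "u \<le> 1" and y: "y = u * x"
      using x xy by (simp_all add: u_def)
    have "1 - u \<le> (1 - u) powr \<beta>" "u \<le> u powr \<beta>"
      using powr_mono'[of \<beta> 1 "1 - u"] powr_mono'[of \<beta> 1 u] u \<beta> by simp_all
    moreover have "(x - y) powr \<beta> = (1 - u) powr \<beta> * x powr \<beta>"
      using u x by (simp add: y flip: powr_mult) (simp add: algebra_simps)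
    ultimately have "x powr \<beta> - (x - y) powr \<beta> \<le> u * x powr \<beta>" "u * x powr \<beta> \<le> u powr \<beta> * x powr \<beta>"
      using mult_right_mono[of "1 - u" "(1 - u) powr \<beta>" "x powr \<beta>"]
      by (simp_all add: left_diff_distrib mult_right_mono)
    moreover have "y * x powr (\<beta> - 1) = u * x powr \<beta>" "y powr \<beta> = u powr \<beta> * x powr \<beta>"
      using x u by (simp_all add: y powr_diff powr_mult)
    ultimately show ?thesis by simp
  qed
  then show "x powr \<beta> - (x - y) powr \<beta> \<le> y * x powr (\<beta> - 1)"
    and "x powr \<beta> - (x - y) powr \<beta> \<le> y powr \<beta>" by auto
qed

context prob_space
begin

text \<open>\<open>f 1 \<le> 0\<close> makes the mean of exp(-D_t) at least 1, while exp(-D_t) \<le>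
  1 almost surely, so equality must hold.\<close>

lemma subordinator_AE_zero:
  assumes D: "subordinator f D" and f: "f 1 \<le> 0" and t: "t \<ge> 0"
  shows "AE \<omega> in M. D t \<omega> = 0"
proof -
  note [measurable] = levy_process_measurable[OF subordinator_levy[OF D] t]
  note nn = subordinator_nonneg[OF D]
  have bd: "AE \<omega> in M. norm (exp (- D t \<omega>)) \<le> 1"
    using nn by eventually_elim (use t in simp)
  have int: "integrable M (\<lambda>\<omega>. exp (- D t \<omega>))"
    by (rule integrable_const_bound[OF bd]) measurable
  have nn': "AE \<omega> in M. 0 \<le> 1 - exp (- D t \<omega>)"
    using bd by eventually_elim simp
  have int': "integrable M (\<lambda>\<omega>. 1 - exp (- D t \<omega>))"
    using int by simp
  have "\<forall>t\<ge>0. \<forall>s>0. expectation (\<lambda>\<omega>. exp (- (s * D t \<omega>))) = exp (- (t * f s))"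
    using D by (simp add: subordinator_def)
  from this[rule_format, OF t, of 1] have "expectation (\<lambda>\<omega>. exp (- D t \<omega>)) = exp (- (t * f 1))"
    by simp
  moreover have "exp (- (t * f 1)) \<ge> 1"
    using f t by (simp add: mult_nonneg_nonpos)
  ultimately have "expectation (\<lambda>\<omega>. 1 - exp (- D t \<omega>)) \<le> 0"
    using int by (simp add: prob_space)
  moreover have "expectation (\<lambda>\<omega>. 1 - exp (- D t \<omega>)) \<ge> 0"
    by (rule integral_nonneg_AE[OF nn'])
  ultimately have "AE \<omega> in M. 1 - exp (- D t \<omega>) = 0"
    using integral_nonneg_eq_0_iff_AE[OF int' nn'] by linarith
  then show ?thesis by eventually_elim simp
qed

lemma subordinator_not_AE_zero:
  assumes D: "subordinator f D" and f: "f 1 > 0" and t: "t > 0"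
  shows "\<not> (AE \<omega> in M. D t \<omega> = 0)"
proof
  assume z: "AE \<omega> in M. D t \<omega> = 0"
  have "(\<integral>\<^sup>+\<omega>. ennreal (exp (- (1 * D t \<omega>))) \<partial>M) = (\<integral>\<^sup>+\<omega>. 1 \<partial>M)"
    by (rule nn_integral_cong_AE, use z in eventually_elim) simp
  moreover have "(\<integral>\<^sup>+\<omega>. ennreal (exp (- (1 * D t \<omega>))) \<partial>M) = ennreal (exp (- (t * f 1)))"
    by (rule subordinator_laplace[OF D]) (use t in auto)
  ultimately have "ennreal (exp (- (t * f 1))) = ennreal 1"
    by (simp add: emeasure_space_1)
  then have "exp (- (t * f 1)) = 1"
    by (subst (asm) ennreal_inj) simp_all
  then show False using f t by simp
qed

text \<open>Dominated convergence: the integrand is at most w D_s D_t^(\<beta>-1), which tends to 0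
  because D_t tends to infinity, and it is dominated by w D_s^\<beta>. The weight w lets one
  argument cover both limits needed later.\<close>

lemma subordinator_powr_increment_limit:
  assumes D: "subordinator f D" and f: "f 1 > 0" and \<beta>: "0 < \<beta>" "\<beta> < 1" and s: "s \<ge> 0"
    and w[measurable]: "w \<in> borel_measurable M" and w0: "AE \<omega> in M. w \<omega> \<ge> 0"
    and int: "integrable M (\<lambda>\<omega>. w \<omega> * D s \<omega> powr \<beta>)"
  shows "((\<lambda>t. expectation (\<lambda>\<omega>. w \<omega> * (D t \<omega> powr \<beta> - (D t \<omega> - D s \<omega>) powr \<beta>))) \<longlongrightarrow> 0) at_top"
proof -
  have m[measurable]: "random_variable borel (D t)" if "t \<ge> 0" for t
    by (rule levy_process_measurable[OF subordinator_levy[OF D] that])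
  note [measurable] = m[OF s]
  \<comment> \<open>\<open>max s t\<close> keeps the later time at least s for every t, so
    measurability and the bounds hold throughout; for t \<ge> s nothing changes.\<close>
  define F where "F t \<omega> = w \<omega> * (D (max s t) \<omega> powr \<beta> - (D (max s t) \<omega> - D s \<omega>) powr \<beta>)" for t \<omega>
  have "((\<lambda>t. expectation (F t)) \<longlongrightarrow> expectation (\<lambda>\<omega>. 0)) at_top"
  proof (rule integral_dominated_convergence_at_top[OF _ _ int])
    show "F t \<in> borel_measurable M" for t
    proof -
      have [measurable]: "random_variable borel (D (max s t))" by (rule m) (use s in simp)
      show ?thesis unfolding F_def[abs_def] by measurable
    qed
    show "AE \<omega> in M. ((\<lambda>t. F t \<omega>) \<longlongrightarrow> 0) at_top"
      using subordinator_at_top[OF D f] subordinator_mono[OF D] subordinator_nonneg[OF D] w0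
    proof eventually_elim
      case (elim \<omega>)
      have "filterlim (\<lambda>t. D (max s t) \<omega>) at_top at_top"
        using elim(1)
      proof (rule filterlim_cong[THEN iffD1, OF refl refl, rotated])
        show "\<forall>\<^sub>F t in at_top. D t \<omega> = D (max s t) \<omega>"
          using eventually_ge_at_top[of s] by eventually_elim (simp add: max_def)
      qed
      then have "((\<lambda>t. D (max s t) \<omega> powr (\<beta> - 1)) \<longlongrightarrow> 0) at_top"
        using \<beta> by (intro tendsto_neg_powr) auto
      then have lim: "((\<lambda>t. w \<omega> * (D s \<omega> * D (max s t) \<omega> powr (\<beta> - 1))) \<longlongrightarrow> 0) at_top"
        by (intro tendsto_mult_right_zero)
      show "((\<lambda>t. F t \<omega>) \<longlongrightarrow> 0) at_top"
      proof (rule tendsto_sandwich[OF _ _ tendsto_const lim])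
        have le0: "0 \<le> D s \<omega>" and le: "D s \<omega> \<le> D (max s t) \<omega>" for t
          using elim s by auto
        show "\<forall>\<^sub>F t in at_top. 0 \<le> F t \<omega>"
        proof (intro always_eventually allI)
          fix t
          have "(D (max s t) \<omega> - D s \<omega>) powr \<beta> \<le> D (max s t) \<omega> powr \<beta>"
            using le0 le[of t] \<beta> by (intro powr_mono2) auto
          then show "0 \<le> F t \<omega>" using elim(4) by (simp add: F_def)
        qed
        show "\<forall>\<^sub>F t in at_top. F t \<omega> \<le> w \<omega> * (D s \<omega> * D (max s t) \<omega> powr (\<beta> - 1))"
          unfolding F_def
          by (intro always_eventually allI mult_left_mono powr_diff_le(1)[OF \<beta>] le0 le elim(4))
      qed
    qed
    show "\<forall>\<^sub>F t in at_top. AE \<omega> in M. norm (F t \<omega>) \<le> w \<omega> * D s \<omega> powr \<beta>"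
    proof (rule always_eventually, rule allI)
      fix t
      show "AE \<omega> in M. norm (F t \<omega>) \<le> w \<omega> * D s \<omega> powr \<beta>"
        using subordinator_mono[OF D] subordinator_nonneg[OF D] w0
      proof eventually_elim
        case (elim \<omega>)
        have le: "0 \<le> D s \<omega>" "D s \<omega> \<le> D (max s t) \<omega>"
          using elim s by auto
        have "(D (max s t) \<omega> - D s \<omega>) powr \<beta> \<le> D (max s t) \<omega> powr \<beta>"
          using le \<beta> by (intro powr_mono2) auto
        then have "norm (F t \<omega>) = F t \<omega>" using elim(3) by (simp add: F_def)
        also have "\<dots> \<le> w \<omega> * D s \<omega> powr \<beta>"
          unfolding F_def by (intro mult_left_mono powr_diff_le(2)[OF \<beta>] le elim(3))
        finally show ?case .
      qed
    qed
  qed simp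
  then have "((\<lambda>t. expectation (F t)) \<longlongrightarrow> 0) at_top" by simp
  moreover have "\<forall>\<^sub>F t in at_top. expectation (F t)
      = expectation (\<lambda>\<omega>. w \<omega> * (D t \<omega> powr \<beta> - (D t \<omega> - D s \<omega>) powr \<beta>))"
    using eventually_ge_at_top[of s] by eventually_elim (simp add: F_def[abs_def] max_def)
  ultimately show ?thesis
    by (rule Lim_transform_eventually)
qed

lemma subordinator_powr_integrable:
  assumes D: "subordinator f D" and \<beta>: "0 < \<beta>" and st: "0 \<le> s" "s \<le> t"
    and int: "\<And>t r. t \<ge> 0 \<Longrightarrow> r > 0 \<Longrightarrow> integrable M (\<lambda>\<omega>. D t \<omega> powr r)"
  shows "integrable M (\<lambda>\<omega>. D s \<omega> powr \<beta> * D t \<omega> powr \<beta>)"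
    and "integrable M (\<lambda>\<omega>. (D t \<omega> - D s \<omega>) powr \<beta>)"
    and "integrable M (\<lambda>\<omega>. D s \<omega> powr \<beta> * (D t \<omega> - D s \<omega>) powr \<beta>)"
proof -
  have t: "0 \<le> t" using st by simp
  note [measurable] = levy_process_measurable[OF subordinator_levy[OF D] t]
    levy_process_measurable[OF subordinator_levy[OF D] st(1)]
  have le: "AE \<omega> in M. 0 \<le> D s \<omega> \<and> D s \<omega> \<le> D t \<omega>"
    using subordinator_mono[OF D] subordinator_nonneg[OF D] by eventually_elim (use st in simp)
  have i2: "integrable M (\<lambda>\<omega>. D t \<omega> powr (\<beta> + \<beta>))" by (rule int) (use \<beta> t in auto)
  show 1: "integrable M (\<lambda>\<omega>. D s \<omega> powr \<beta> * D t \<omega> powr \<beta>)"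
  proof (rule Bochner_Integration.integrable_bound[OF i2])
    show "AE \<omega> in M. norm (D s \<omega> powr \<beta> * D t \<omega> powr \<beta>) \<le> norm (D t \<omega> powr (\<beta> + \<beta>))"
      using le by eventually_elim (use \<beta> in \<open>simp only: powr_add, simp add: powr_mono2 mult_right_mono\<close>)
  qed measurable
  have i1: "integrable M (\<lambda>\<omega>. D t \<omega> powr \<beta>)" by (rule int) (use \<beta> t in auto)
  show "integrable M (\<lambda>\<omega>. (D t \<omega> - D s \<omega>) powr \<beta>)"
  proof (rule Bochner_Integration.integrable_bound[OF i1])
    show "AE \<omega> in M. norm ((D t \<omega> - D s \<omega>) powr \<beta>) \<le> norm (D t \<omega> powr \<beta>)"
      using le by eventually_elim (use \<beta> in \<open>simp add: powr_mono2\<close>)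
  qed measurable
  show "integrable M (\<lambda>\<omega>. D s \<omega> powr \<beta> * (D t \<omega> - D s \<omega>) powr \<beta>)"
  proof (rule Bochner_Integration.integrable_bound[OF 1])
    show "AE \<omega> in M. norm (D s \<omega> powr \<beta> * (D t \<omega> - D s \<omega>) powr \<beta>) \<le> norm (D s \<omega> powr \<beta> * D t \<omega> powr \<beta>)"
      using le by eventually_elim (use \<beta> in \<open>simp add: powr_mono2 mult_left_mono abs_mult\<close>)
  qed measurable
qed

lemma subordinator_powr_increment:
  assumes D: "subordinator f D" and \<beta>: "0 < \<beta>" and st: "0 \<le> s" "s \<le> t"
    and int: "\<And>t r. t \<ge> 0 \<Longrightarrow> r > 0 \<Longrightarrow> integrable M (\<lambda>\<omega>. D t \<omega> powr r)"
  shows "expectation (\<lambda>\<omega>. (D t \<omega> - D s \<omega>) powr \<beta>) = expectation (\<lambda>\<omega>. D (t - s) \<omega> powr \<beta>)"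
    and "expectation (\<lambda>\<omega>. D s \<omega> powr \<beta> * (D t \<omega> - D s \<omega>) powr \<beta>)
       = expectation (\<lambda>\<omega>. D s \<omega> powr \<beta>) * expectation (\<lambda>\<omega>. D (t - s) \<omega> powr \<beta>)"
proof -
  have t: "0 \<le> t" and d: "0 \<le> t - s" using st by simp_all
  note L = subordinator_levy[OF D]
  note [measurable] = levy_process_measurable[OF L t] levy_process_measurable[OF L st(1)] levy_process_measurable[OF L d]
  have i: "(\<integral>\<^sup>+\<omega>. ennreal (D u \<omega> powr \<beta>) \<partial>M) = ennreal (expectation (\<lambda>\<omega>. D u \<omega> powr \<beta>))" if "u \<ge> 0" for u
    by (rule nn_integral_eq_integral[OF int]) (use that \<beta> in auto)
  have nn: "0 \<le> expectation (\<lambda>\<omega>. D u \<omega> powr \<beta>)" for u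
    by (rule Bochner_Integration.integral_nonneg) simp
  have "(\<integral>\<^sup>+\<omega>. ennreal ((D t \<omega> - D s \<omega>) powr \<beta>) \<partial>M) = (\<integral>\<^sup>+\<omega>. \<integral>\<^sup>+\<omega>'. ennreal (D (t - s) \<omega>' powr \<beta>) \<partial>M \<partial>M)"
    by (rule levy_process_nn_integral_increment[OF L st, of "\<lambda>x y. ennreal (y powr \<beta>)"]) measurable
  also have "\<dots> = ennreal (expectation (\<lambda>\<omega>. D (t - s) \<omega> powr \<beta>))"
    by (simp add: i[OF d] emeasure_space_1)
  finally show "expectation (\<lambda>\<omega>. (D t \<omega> - D s \<omega>) powr \<beta>) = expectation (\<lambda>\<omega>. D (t - s) \<omega> powr \<beta>)"
    by (subst (asm) nn_integral_eq_integrable) (simp_all add: nn)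
  have "(\<integral>\<^sup>+\<omega>. ennreal (D s \<omega> powr \<beta> * (D t \<omega> - D s \<omega>) powr \<beta>) \<partial>M)
      = (\<integral>\<^sup>+\<omega>. \<integral>\<^sup>+\<omega>'. ennreal (D s \<omega> powr \<beta> * D (t - s) \<omega>' powr \<beta>) \<partial>M \<partial>M)"
    by (rule levy_process_nn_integral_increment[OF L st, of "\<lambda>x y. ennreal (x powr \<beta> * y powr \<beta>)"]) measurable
  also have "\<dots> = ennreal (expectation (\<lambda>\<omega>. D s \<omega> powr \<beta>)) * ennreal (expectation (\<lambda>\<omega>. D (t - s) \<omega> powr \<beta>))"
    by (simp add: ennreal_mult nn_integral_cmult nn_integral_multc i[OF d] i[OF st(1)])
  also have "\<dots> = ennreal (expectation (\<lambda>\<omega>. D s \<omega> powr \<beta>) * expectation (\<lambda>\<omega>. D (t - s) \<omega> powr \<beta>))"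
    by (simp add: ennreal_mult nn)
  finally show "expectation (\<lambda>\<omega>. D s \<omega> powr \<beta> * (D t \<omega> - D s \<omega>) powr \<beta>)
       = expectation (\<lambda>\<omega>. D s \<omega> powr \<beta>) * expectation (\<lambda>\<omega>. D (t - s) \<omega> powr \<beta>)"
    by (subst (asm) nn_integral_eq_integrable) (simp_all add: nn)
qed

text \<open>The weights w = 1 and w = D_s^\<beta>. In both cases the shifted term is rewritten
  through \<open>A(t - s)\<close>, the mean of D_(t-s)^\<beta>, by stationarity and, for the second
  weight, independence of increments.\<close>

lemma subordinator_powr_limits:
  assumes D: "subordinator f D" and f: "f 1 > 0" and \<beta>: "0 < \<beta>" "\<beta> < 1" and s: "s \<ge> 0"
    and int: "\<And>t r. t \<ge> 0 \<Longrightarrow> r > 0 \<Longrightarrow> integrable M (\<lambda>\<omega>. D t \<omega> powr r)"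
  shows "((\<lambda>t. expectation (\<lambda>\<omega>. D t \<omega> powr \<beta>) - expectation (\<lambda>\<omega>. D (t - s) \<omega> powr \<beta>)) \<longlongrightarrow> 0) at_top"
    and "((\<lambda>t. expectation (\<lambda>\<omega>. D s \<omega> powr \<beta> * D t \<omega> powr \<beta>)
           - expectation (\<lambda>\<omega>. D s \<omega> powr \<beta>) * expectation (\<lambda>\<omega>. D (t - s) \<omega> powr \<beta>)) \<longlongrightarrow> 0) at_top"
proof -
  note [measurable] = levy_process_measurable[OF subordinator_levy[OF D] s]
  note inc = subordinator_powr_increment[OF D \<beta>(1) s _ int] and
    I = subordinator_powr_integrable[OF D \<beta>(1) s _ int]
  have "((\<lambda>t. expectation (\<lambda>\<omega>. 1 * (D t \<omega> powr \<beta> - (D t \<omega> - D s \<omega>) powr \<beta>))) \<longlongrightarrow> 0) at_top"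
    by (rule subordinator_powr_increment_limit[OF D f \<beta> s]) (use int s \<beta> in simp_all)
  moreover have "\<forall>\<^sub>F t in at_top. expectation (\<lambda>\<omega>. 1 * (D t \<omega> powr \<beta> - (D t \<omega> - D s \<omega>) powr \<beta>))
      = expectation (\<lambda>\<omega>. D t \<omega> powr \<beta>) - expectation (\<lambda>\<omega>. D (t - s) \<omega> powr \<beta>)"
    using eventually_ge_at_top[of s]
  proof eventually_elim
    case (elim t)
    then show ?case
      using inc(1)[of t] I(2)[of t] int[of t \<beta>] s \<beta> by simp
  qed
  ultimately show "((\<lambda>t. expectation (\<lambda>\<omega>. D t \<omega> powr \<beta>) - expectation (\<lambda>\<omega>. D (t - s) \<omega> powr \<beta>)) \<longlongrightarrow> 0) at_top"
    by (rule Lim_transform_eventually)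
  have "((\<lambda>t. expectation (\<lambda>\<omega>. D s \<omega> powr \<beta> * (D t \<omega> powr \<beta> - (D t \<omega> - D s \<omega>) powr \<beta>))) \<longlongrightarrow> 0) at_top"
    by (rule subordinator_powr_increment_limit[OF D f \<beta> s]) (use I(1)[of s] s in simp_all)
  moreover have "\<forall>\<^sub>F t in at_top. expectation (\<lambda>\<omega>. D s \<omega> powr \<beta> * (D t \<omega> powr \<beta> - (D t \<omega> - D s \<omega>) powr \<beta>))
      = expectation (\<lambda>\<omega>. D s \<omega> powr \<beta> * D t \<omega> powr \<beta>)
           - expectation (\<lambda>\<omega>. D s \<omega> powr \<beta>) * expectation (\<lambda>\<omega>. D (t - s) \<omega> powr \<beta>)"
    using eventually_ge_at_top[of s]
  proof eventually_elim
    case (elim t)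
    then show ?case
      using inc(2)[of t] I(1)[of t] I(3)[of t] by (simp add: right_diff_distrib)
  qed
  ultimately show "((\<lambda>t. expectation (\<lambda>\<omega>. D s \<omega> powr \<beta> * D t \<omega> powr \<beta>)
           - expectation (\<lambda>\<omega>. D s \<omega> powr \<beta>) * expectation (\<lambda>\<omega>. D (t - s) \<omega> powr \<beta>)) \<longlongrightarrow> 0) at_top"
    by (rule Lim_transform_eventually)
qed

text \<open>Linear growth of the mean; this excludes $\beta = 1$ in the theorem.\<close>

lemma subordinator_mean_not_sublinear:
  assumes D: "subordinator f D" and int: "\<And>t. t \<ge> 0 \<Longrightarrow> integrable M (D t)"
    and k: "k > 0" and \<rho>: "\<rho> < 1"
  shows "\<not> (\<lambda>t. expectation (D t)) \<sim>[at_top] (\<lambda>t. k * t powr \<rho>)"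
proof
  assume asy: "(\<lambda>t. expectation (D t)) \<sim>[at_top] (\<lambda>t. k * t powr \<rho>)"
  have step: "expectation (D (t + 1)) = expectation (D t) + expectation (D 1)" if t: "t \<ge> 0" for t
  proof -
    have [measurable]: "random_variable borel (D u)" if "u \<ge> 0" for u
      by (rule levy_process_measurable[OF subordinator_levy[OF D] that])
    have "expectation (D 1) = (\<integral>x. x \<partial>distr M borel (D 1))"
      by (simp add: integral_distr)
    also have "distr M borel (D 1) = distr M borel (\<lambda>\<omega>. D (t + 1) \<omega> - D t \<omega>)"
      using subordinator_levy[OF D] t by (simp add: levy_process_def)
    also have "(\<integral>x. x \<partial>distr M borel (\<lambda>\<omega>. D (t + 1) \<omega> - D t \<omega>)) = expectation (\<lambda>\<omega>. D (t + 1) \<omega> - D t \<omega>)"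
      using t by (simp add: integral_distr)
    also have "\<dots> = expectation (D (t + 1)) - expectation (D t)"
      by (rule Bochner_Integration.integral_diff) (use int t in auto)
    finally show ?thesis by simp
  qed
  have "AE \<omega> in M. D 0 \<omega> = 0"
    using D by (simp add: subordinator_def levy_process_def)
  then have zero: "expectation (D 0) = 0"
    using integral_cong_AE[of "D 0" M "\<lambda>_. 0"] int[of 0] by simp
  have lin: "expectation (D (real n)) = real n * expectation (D 1)" for n
  proof (induction n)
    case (Suc n)
    then show ?case using step[of "real n"] by (simp add: algebra_simps)
  qed (simp add: zero)
  define c where "c = expectation (D 1) / k"
  have "((\<lambda>t. if expectation (D t) = 0 \<and> k * t powr \<rho> = 0 then 1 else expectation (D t) / (k * t powr \<rho>)) \<longlongrightarrow> 1) at_top"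
    using asymp_equivD[OF asy] .
  from filterlim_compose[OF this filterlim_real_sequentially]
  have "(\<lambda>n. if expectation (D (real n)) = 0 \<and> k * real n powr \<rho> = 0 then 1
      else expectation (D (real n)) / (k * real n powr \<rho>)) \<longlonglongrightarrow> 1" .
  moreover have "\<forall>\<^sub>F n in sequentially. (if expectation (D (real n)) = 0 \<and> k * real n powr \<rho> = 0 then 1
      else expectation (D (real n)) / (k * real n powr \<rho>)) = c * real n powr (1 - \<rho>)"
    using eventually_gt_at_top[of 0]
    by eventually_elim (use k in \<open>simp add: lin c_def powr_diff\<close>)
  ultimately have lim: "(\<lambda>n. c * real n powr (1 - \<rho>)) \<longlonglongrightarrow> 1"
    by (rule Lim_transform_eventually)
  \<comment> \<open>Multiplication by a power tending to 0 leaves the constant c, so c = 0; the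
    preceding limit would then be 0 instead of 1.\<close>
  have "(\<lambda>n. real n powr (- (1 - \<rho>))) \<longlonglongrightarrow> 0"
    using \<rho> by (intro tendsto_neg_powr filterlim_real_sequentially) simp
  from tendsto_mult[OF lim this] have "(\<lambda>n. c * real n powr (1 - \<rho>) * real n powr (- (1 - \<rho>))) \<longlonglongrightarrow> 0"
    by simp
  moreover have "\<forall>\<^sub>F n in sequentially. c * real n powr (1 - \<rho>) * real n powr (- (1 - \<rho>)) = c"
    using eventually_gt_at_top[of 0]
  proof eventually_elim
    case (elim n)
    then show ?case by (simp add: mult.assoc flip: powr_add)
  qed
  ultimately have "(\<lambda>n. c) \<longlonglongrightarrow> 0"
    by (rule Lim_transform_eventually)
  then have "c = 0" by (simp add: LIMSEQ_const_iff)
  with lim show False by (simp add: LIMSEQ_const_iff)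
qed

end

subsection \<open>Long-range dependence\<close>

lemma (in prob_space) covariance_eq:
  assumes "integrable M U" "integrable M V" "integrable M (\<lambda>\<omega>. U \<omega> * V \<omega>)"
  shows "covariance U V = expectation (\<lambda>\<omega>. U \<omega> * V \<omega>) - expectation U * expectation V"
proof -
  have "covariance U V = expectation (\<lambda>\<omega>. U \<omega> * V \<omega> - expectation V * U \<omega> - expectation U * V \<omega> + expectation U * expectation V)"
    unfolding covariance_def by (rule Bochner_Integration.integral_cong) (simp_all add: algebra_simps)
  also have "\<dots> = expectation (\<lambda>\<omega>. U \<omega> * V \<omega>) - expectation U * expectation V"
    using assms by (simp add: prob_space)
  finally show ?thesis .
qed

text \<open>For t > 0 the comparison function is nonzero, so the convention 0/0 = 1 inside
  \<open>asymp_equivD\<close> drops out and the plain quotient remains.\<close>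

lemma asymp_equiv_tendsto_quotient:
  fixes g :: "real \<Rightarrow> real"
  assumes "g \<sim>[at_top] (\<lambda>t. k * t powr r)" "k > 0"
  shows "((\<lambda>t. g t / t powr r) \<longlongrightarrow> k) at_top"
proof -
  have "((\<lambda>t. k * (if g t = 0 \<and> k * t powr r = 0 then 1 else g t / (k * t powr r))) \<longlongrightarrow> k * 1) at_top"
    by (intro tendsto_mult tendsto_const asymp_equivD assms(1))
  moreover have "\<forall>\<^sub>F t in at_top. k * (if g t = 0 \<and> k * t powr r = 0 then 1 else g t / (k * t powr r)) = g t / t powr r"
    using eventually_gt_at_top[of 0] by eventually_elim (use assms(2) in simp)
  ultimately show ?thesis
    using Lim_transform_eventually by fastforce
qed

theorem theorem3p4:
  fixes M :: "'a measure"
    and X D :: "real \<Rightarrow> 'a \<Rightarrow> real"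
    and f :: "real \<Rightarrow> real"
    and \<beta> lam \<rho> k1 k2 :: real
  assumes "prob_space M"
    and "0 < \<beta>" and "\<beta> \<le> 1" and "lam > 0"
    and "prob_space.fractional_poisson_process M \<beta> lam X"
    and "prob_space.subordinator M f D"
    and "prob_space.indep_processes M X D"
    and "\<And>t r. t \<ge> 0 \<Longrightarrow> r > 0 \<Longrightarrow> integrable M (\<lambda>\<omega>. D t \<omega> powr r)"
    and "\<And>t. t \<ge> 0 \<Longrightarrow> (\<lambda>\<omega>. X (D t \<omega>) \<omega>) \<in> borel_measurable M"
    and "0 < \<rho>" and "\<rho> < 1" and "k1 > 0" and "k2 > 0" and "k2 \<ge> k1\<^sup>2"
    and "(\<lambda>t. \<integral>\<omega>. D t \<omega> powr \<beta> \<partial>M) \<sim>[at_top] (\<lambda>t. k1 * t powr \<rho>)"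
    and "(\<lambda>t. \<integral>\<omega>. D t \<omega> powr (2 * \<beta>) \<partial>M) \<sim>[at_top] (\<lambda>t. k2 * t powr (2 * \<rho>))"
  shows "prob_space.long_range_dependent M (\<lambda>t \<omega>. X (D t \<omega>) \<omega>)"
proof -
  interpret prob_space M by fact
  note D = assms(6) and int = assms(8)
  note D_nonneg = subordinator_nonneg[OF D]
  have D_meas[measurable]: "random_variable borel (D t)" if "t \<ge> 0" for t
    by (rule levy_process_measurable[OF subordinator_levy[OF D] that])
  have sq: "(x powr r)\<^sup>2 = x powr (2 * r)" for x r :: real
    by (simp add: power2_eq_square flip: powr_add)
  define A where "A t = expectation (\<lambda>\<omega>. D t \<omega> powr \<beta>)" for t
  define B where "B t = expectation (\<lambda>\<omega>. D t \<omega> powr (2 * \<beta>))" for t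
  have A_lim: "((\<lambda>t. A t / t powr \<rho>) \<longlongrightarrow> k1) at_top"
    and B_lim: "((\<lambda>t. B t / t powr (2 * \<rho>)) \<longlongrightarrow> k2) at_top"
    unfolding A_def B_def by (rule asymp_equiv_tendsto_quotient; fact)+
  have A_nonneg: "0 \<le> A t" and B_nonneg: "0 \<le> B t" for t
    by (simp_all add: A_def B_def)
  have "\<beta> \<noteq> 1"
  proof
    assume \<beta>1: "\<beta> = 1"
    \<comment> \<open>The power with exponent 1 returns its base only for nonnegative bases, so the
      passage from \<open>D t powr 1\<close> to \<open>D t\<close> is almost sure.\<close>
    have eq: "AE \<omega> in M. D t \<omega> powr 1 = D t \<omega>" if "t \<ge> 0" for t
      using D_nonneg by eventually_elim (use that in simp)
    have i: "integrable M (D t)" if t: "t \<ge> 0" for t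
      using integrable_cong_AE[of "\<lambda>\<omega>. D t \<omega> powr 1" M "D t"] eq[OF t] int[OF t, of 1] D_meas[OF t] by simp
    have mean: "expectation (D t) = A t" if "t \<ge> 0" for t
      unfolding A_def \<beta>1 using eq[OF that] D_meas[OF that] by (intro integral_cong_AE) auto
    have ev: "\<forall>\<^sub>F t in at_top. A t = expectation (D t)"
      using eventually_ge_at_top[of 0] by eventually_elim (simp add: mean)
    have "A \<sim>[at_top] (\<lambda>t. k1 * t powr \<rho>)"
      using assms(15) by (simp add: A_def[abs_def])
    then have "(\<lambda>t. expectation (D t)) \<sim>[at_top] (\<lambda>t. k1 * t powr \<rho>)"
      using asymp_equiv_cong[OF ev, of "\<lambda>t. k1 * t powr \<rho>" "\<lambda>t. k1 * t powr \<rho>"] by simp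
    with subordinator_mean_not_sublinear[OF D i assms(12) assms(11)] show False by blast
  qed
  with assms have \<beta>: "0 < \<beta>" "\<beta> < 1" by auto
  \<comment> \<open>Otherwise D vanishes almost surely at each time and its moments cannot grow like
    k1 t^\<rho>. Positivity of \<open>f 1\<close> drives D to infinity and makes A positive.\<close>
  have f1: "f 1 > 0"
  proof (rule ccontr)
    assume "\<not> f 1 > 0"
    then have z: "AE \<omega> in M. D t \<omega> = 0" if "t \<ge> 0" for t
      using subordinator_AE_zero[OF D _ that] by simp
    have A0: "A t = 0" if t: "t \<ge> 0" for t
    proof -
      have "A t = expectation (\<lambda>\<omega>. 0)"
        unfolding A_def using D_meas[OF t]
        by (intro integral_cong_AE) (use z[OF t] in \<open>auto elim: eventually_mono\<close>)
      then show ?thesis by simp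
    qed
    have "\<forall>\<^sub>F t in at_top. A t / t powr \<rho> = 0"
      using eventually_ge_at_top[of 0] by eventually_elim (simp add: A0)
    with A_lim have "((\<lambda>t::real. 0) \<longlongrightarrow> k1) at_top"
      by (rule Lim_transform_eventually)
    then show False using \<open>k1 > 0\<close> by (simp add: tendsto_const_iff)
  qed
  have A_pos: "A t > 0" if t: "t > 0" for t
  proof (rule ccontr)
    assume "\<not> A t > 0"
    then have "A t = 0" using A_nonneg[of t] by simp
    then have "AE \<omega> in M. D t \<omega> powr \<beta> = 0"
      unfolding A_def using integral_nonneg_eq_0_iff_AE[OF int[of t \<beta>]] t \<beta> by simp
    then have "AE \<omega> in M. D t \<omega> = 0" by simp
    with subordinator_not_AE_zero[OF D f1 t] show False by blast
  qed
  obtain q k H where q: "q > 0" and k: "k > 1 / 2"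
    and rcX: "AE \<omega> in M. \<forall>t\<ge>0. ((\<lambda>u. X u \<omega>) \<longlongrightarrow> X t \<omega>) (at_right t)"
    and X_nonneg: "\<And>t. t \<ge> 0 \<Longrightarrow> AE \<omega> in M. X t \<omega> \<ge> 0"
    and X_mean: "\<And>t. t \<ge> 0 \<Longrightarrow> (\<integral>\<^sup>+\<omega>. ennreal (X t \<omega>) \<partial>M) = ennreal (q * t powr \<beta>)"
    and X_mult: "\<And>s t. 0 \<le> s \<Longrightarrow> s \<le> t \<Longrightarrow> (\<integral>\<^sup>+\<omega>. ennreal (X s \<omega> * X t \<omega>) \<partial>M)
       = ennreal (q * s powr \<beta> + q\<^sup>2 * (k * s powr (2 * \<beta>) + H s t))"
    and H_ge: "\<And>s t. 0 \<le> s \<Longrightarrow> s \<le> t \<Longrightarrow> s powr \<beta> * (t - s) powr \<beta> \<le> H s t"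
    and H_le: "\<And>s t. 0 \<le> s \<Longrightarrow> s \<le> t \<Longrightarrow> H s t \<le> s powr \<beta> * t powr \<beta>"
    and H_diag: "\<And>t. 0 \<le> t \<Longrightarrow> H t t = k * t powr (2 * \<beta>)"
    and H_meas: "case_prod H \<in> borel_measurable (borel \<Otimes>\<^sub>M borel)"
  proof (rule fractional_poisson_process_moments[OF \<beta> assms(4,5)], goal_cases)
    case (1 q k H)
    show thesis by (rule that) (fact 1)+
  qed
  note [measurable] = H_meas

  \<comment> \<open>Moments of the time-changed process\<close>
  define Q where "Q t \<omega> = X (D t \<omega>) \<omega>" for t \<omega>
  define C where "C s t = expectation (\<lambda>\<omega>. H (D s \<omega>) (D t \<omega>))" for s t
  have Q_meas[measurable]: "Q t \<in> borel_measurable M" if "t \<ge> 0" for t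
    unfolding Q_def[abs_def] by (rule assms(9)[OF that])
  have tc: "(\<integral>\<^sup>+\<omega>. h (Q s \<omega>) (Q t \<omega>) \<partial>M) = (\<integral>\<^sup>+\<omega>. \<integral>\<^sup>+\<omega>'. h (X (D s \<omega>) \<omega>') (X (D t \<omega>) \<omega>') \<partial>M \<partial>M)"
    if "0 \<le> s" "0 \<le> t" and "case_prod h \<in> borel_measurable (borel \<Otimes>\<^sub>M borel)"
    for s t and h :: "real \<Rightarrow> real \<Rightarrow> ennreal"
    unfolding Q_def by (rule nn_integral_time_change[OF assms(7) rcX D_nonneg that(3,1,2)])
  have D_le: "AE \<omega> in M. 0 \<le> D s \<omega> \<and> D s \<omega> \<le> D t \<omega>" if "0 \<le> s" "s \<le> t" for s t
    using subordinator_mono[OF D] D_nonneg by eventually_elim (use that in simp)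
  have Q_nonneg: "AE \<omega> in M. Q t \<omega> \<ge> 0" if t: "t \<ge> 0" for t
    by (rule time_change_nonneg[OF assms(7) rcX D_nonneg X_nonneg Q_meas[OF t] _ t]) (simp_all add: Q_def)
  have Q_mean: "integrable M (Q t)" "expectation (Q t) = q * A t" if t: "t \<ge> 0" for t
  proof -
    note [measurable] = Q_meas[OF t] D_meas[OF t]
    have i: "integrable M (\<lambda>\<omega>. q * D t \<omega> powr \<beta>)" using int[OF t \<beta>(1)] by simp
    have "(\<integral>\<^sup>+\<omega>. ennreal (Q t \<omega>) \<partial>M) = (\<integral>\<^sup>+\<omega>. \<integral>\<^sup>+\<omega>'. ennreal (X (D t \<omega>) \<omega>') \<partial>M \<partial>M)"
      by (rule tc[of t t "\<lambda>x y. ennreal x", OF t t]) measurable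
    also have "\<dots> = (\<integral>\<^sup>+\<omega>. ennreal (q * D t \<omega> powr \<beta>) \<partial>M)"
      by (rule nn_integral_cong_AE, use D_nonneg in eventually_elim) (use t in \<open>simp add: X_mean\<close>)
    also have "\<dots> = ennreal (expectation (\<lambda>\<omega>. q * D t \<omega> powr \<beta>))"
      by (rule nn_integral_eq_integral[OF i]) (use q in simp)
    also have "expectation (\<lambda>\<omega>. q * D t \<omega> powr \<beta>) = q * A t"
      by (simp add: A_def)
    finally have "integrable M (Q t) \<and> expectation (Q t) = q * A t"
      using nn_integral_eq_integrable[of "Q t" M "q * A t"] Q_nonneg[OF t] q A_nonneg[of t] by simp
    then show "integrable M (Q t)" "expectation (Q t) = q * A t" by auto
  qed
  have powr_int: "integrable M (\<lambda>\<omega>. D s \<omega> powr \<beta> * D t \<omega> powr \<beta>)"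
    "integrable M (\<lambda>\<omega>. D s \<omega> powr \<beta> * (D t \<omega> - D s \<omega>) powr \<beta>)" if "0 \<le> s" "s \<le> t" for s t
    by (rule subordinator_powr_integrable[OF D \<beta>(1) that int]; assumption)+
  have H_int: "integrable M (\<lambda>\<omega>. H (D s \<omega>) (D t \<omega>))" if st: "0 \<le> s" "s \<le> t" for s t
  proof (rule Bochner_Integration.integrable_bound[OF powr_int(1)[OF st]])
    have t: "t \<ge> 0" using st by simp
    note [measurable] = D_meas[OF st(1)] D_meas[OF t]
    show "(\<lambda>\<omega>. H (D s \<omega>) (D t \<omega>)) \<in> borel_measurable M" by measurable
    show "AE \<omega> in M. norm (H (D s \<omega>) (D t \<omega>)) \<le> norm (D s \<omega> powr \<beta> * D t \<omega> powr \<beta>)"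
      using D_le[OF st]
    proof eventually_elim
      case (elim \<omega>)
      have "0 \<le> D s \<omega> powr \<beta> * (D t \<omega> - D s \<omega>) powr \<beta>" by simp
      also have "\<dots> \<le> H (D s \<omega>) (D t \<omega>)" using elim by (intro H_ge) auto
      finally show ?case using H_le[of "D s \<omega>" "D t \<omega>"] elim by simp
    qed
  qed
  have Q_mult: "integrable M (\<lambda>\<omega>. Q s \<omega> * Q t \<omega>)"
    "expectation (\<lambda>\<omega>. Q s \<omega> * Q t \<omega>) = q * A s + q\<^sup>2 * (k * B s + C s t)" if st: "0 \<le> s" "s \<le> t" for s t
  proof -
    have t: "t \<ge> 0" using st by simp
    note [measurable] = D_meas[OF st(1)] D_meas[OF t] Q_meas[OF st(1)] Q_meas[OF t]
    \<comment> \<open>\<open>G\<close> is the mean of \<open>Q s * Q t\<close> conditional on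
      D.\<close>
    define G where "G \<omega> = q * D s \<omega> powr \<beta> + q\<^sup>2 * (k * D s \<omega> powr (2 * \<beta>) + H (D s \<omega>) (D t \<omega>))" for \<omega>
    have i1: "integrable M (\<lambda>\<omega>. D s \<omega> powr \<beta>)" and i2: "integrable M (\<lambda>\<omega>. D s \<omega> powr (2 * \<beta>))"
      using int[OF st(1)] \<beta> by simp_all
    have G: "integrable M G" "expectation G = q * A s + q\<^sup>2 * (k * B s + C s t)"
      unfolding G_def[abs_def] A_def B_def C_def using i1 i2 H_int[OF st] by simp_all
    have G_nonneg: "AE \<omega> in M. 0 \<le> G \<omega>"
      using D_le[OF st]
    proof eventually_elim
      case (elim \<omega>)
      have "0 \<le> D s \<omega> powr \<beta> * (D t \<omega> - D s \<omega>) powr \<beta>" by simp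
      also have "\<dots> \<le> H (D s \<omega>) (D t \<omega>)" using elim by (intro H_ge) auto
      finally show ?case using q k by (simp add: G_def)
    qed
    have "(\<integral>\<^sup>+\<omega>. ennreal (Q s \<omega> * Q t \<omega>) \<partial>M) = (\<integral>\<^sup>+\<omega>. \<integral>\<^sup>+\<omega>'. ennreal (X (D s \<omega>) \<omega>' * X (D t \<omega>) \<omega>') \<partial>M \<partial>M)"
      by (rule tc[of s t "\<lambda>x y. ennreal (x * y)", OF st(1) t]) measurable
    also have "\<dots> = (\<integral>\<^sup>+\<omega>. ennreal (G \<omega>) \<partial>M)"
      by (rule nn_integral_cong_AE, use D_le[OF st] in eventually_elim) (simp add: X_mult G_def)
    also have "\<dots> = ennreal (expectation G)"
      by (rule nn_integral_eq_integral[OF G(1) G_nonneg])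
    finally have "(\<integral>\<^sup>+\<omega>. ennreal (Q s \<omega> * Q t \<omega>) \<partial>M) = ennreal (expectation G)" .
    moreover have "AE \<omega> in M. 0 \<le> Q s \<omega> * Q t \<omega>"
      using Q_nonneg[OF st(1)] Q_nonneg[OF t] by eventually_elim simp
    moreover have "0 \<le> expectation G" by (rule integral_nonneg_AE[OF G_nonneg])
    ultimately have "integrable M (\<lambda>\<omega>. Q s \<omega> * Q t \<omega>) \<and> expectation (\<lambda>\<omega>. Q s \<omega> * Q t \<omega>) = expectation G"
      by (subst nn_integral_eq_integrable[symmetric]) simp_all
    then show "integrable M (\<lambda>\<omega>. Q s \<omega> * Q t \<omega>)"
      "expectation (\<lambda>\<omega>. Q s \<omega> * Q t \<omega>) = q * A s + q\<^sup>2 * (k * B s + C s t)"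
      using G(2) by auto
  qed
  \<comment> \<open>Grouped so that \<open>C s t - A s * A t\<close> is the only part that depends
    on t.\<close>
  have cov: "covariance (Q s) (Q t) = q * A s + q\<^sup>2 * (k * B s + (C s t - A s * A t))" if st: "0 \<le> s" "s \<le> t" for s t
    using covariance_eq[OF Q_mean(1) Q_mean(1) Q_mult(1)[OF st]] Q_mean(2) Q_mult(2)[OF st] st
    by (simp add: power2_eq_square algebra_simps)
  have var: "variance (Q t) = q * A t + q\<^sup>2 * (2 * k * B t - (A t)\<^sup>2)" if t: "t \<ge> 0" for t
  proof -
    have "C t t = expectation (\<lambda>\<omega>. k * D t \<omega> powr (2 * \<beta>))"
      unfolding C_def
    proof (rule integral_cong_AE)
      note [measurable] = D_meas[OF t]
      show "(\<lambda>\<omega>. H (D t \<omega>) (D t \<omega>)) \<in> borel_measurable M" "(\<lambda>\<omega>. k * D t \<omega> powr (2 * \<beta>)) \<in> borel_measurable M"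
        by measurable
      show "AE \<omega> in M. H (D t \<omega>) (D t \<omega>) = k * D t \<omega> powr (2 * \<beta>)"
        using D_nonneg by eventually_elim (use t in \<open>simp add: H_diag\<close>)
    qed
    then have "C t t = k * B t" by (simp add: B_def)
    moreover have "variance (Q t) = covariance (Q t) (Q t)"
      by (simp add: covariance_def power2_eq_square)
    ultimately show ?thesis
      using cov[OF t order.refl] by (simp add: power2_eq_square algebra_simps)
  qed
  \<comment> \<open>With 2k > 1 this keeps the quadratic part of the variance nonnegative at every
    fixed time, where no asymptotics are available.\<close>
  have Jensen: "(A t)\<^sup>2 \<le> B t" if t: "t \<ge> 0" for t
  proof -
    have i: "integrable M (\<lambda>\<omega>. D t \<omega> powr \<beta>)" "integrable M (\<lambda>\<omega>. (D t \<omega> powr \<beta>)\<^sup>2)"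
      using int[OF t, of \<beta>] int[OF t, of "2 * \<beta>"] \<beta> by (simp_all add: sq)
    have "0 \<le> variance (\<lambda>\<omega>. D t \<omega> powr \<beta>)" by simp
    then show ?thesis
      unfolding variance_eq[OF i] by (simp add: A_def B_def sq)
  qed
  have var_pos: "variance (Q s) > 0" if s: "s > 0" for s
  proof -
    have "1 * B s \<le> 2 * k * B s"
      using k B_nonneg[of s] by (intro mult_right_mono) auto
    then have "0 \<le> 2 * k * B s - (A s)\<^sup>2" using Jensen[of s] s by simp
    moreover have "0 < q * A s" using q A_pos[OF s] by simp
    ultimately show ?thesis using s by (subst var) (auto intro: add_pos_nonneg)
  qed

  \<comment> \<open>Limits of variance, covariance and correlation\<close>
  define c0 where "c0 = q\<^sup>2 * (2 * k * k2 - k1\<^sup>2)"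
  have "1 * k2 < 2 * k * k2" using k \<open>k2 > 0\<close> by (intro mult_strict_right_mono) auto
  then have c0: "c0 > 0" using q \<open>k2 \<ge> k1\<^sup>2\<close> by (simp add: c0_def)
  have var_lim: "((\<lambda>t. variance (Q t) / t powr (2 * \<rho>)) \<longlongrightarrow> c0) at_top"
  proof -
    \<comment> \<open>The term linear in A has order t^\<rho> and disappears after division by
      t^(2\<rho>).\<close>
    have "((\<lambda>t. t powr (- \<rho>)) \<longlongrightarrow> 0) at_top"
      using \<open>0 < \<rho>\<close> by (intro tendsto_neg_powr filterlim_ident) simp
    then have "((\<lambda>t. q * (A t / t powr \<rho> * t powr (- \<rho>)) + q\<^sup>2 * (2 * k * (B t / t powr (2 * \<rho>)) - (A t / t powr \<rho>)\<^sup>2))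
        \<longlongrightarrow> q * (k1 * 0) + q\<^sup>2 * (2 * k * k2 - k1\<^sup>2)) at_top"
      by (intro tendsto_add tendsto_mult tendsto_diff tendsto_power tendsto_const A_lim B_lim)
    then have "((\<lambda>t. q * (A t / t powr \<rho> * t powr (- \<rho>)) + q\<^sup>2 * (2 * k * (B t / t powr (2 * \<rho>)) - (A t / t powr \<rho>)\<^sup>2))
        \<longlongrightarrow> c0) at_top"
      by (simp add: c0_def)
    moreover have "\<forall>\<^sub>F t in at_top. q * (A t / t powr \<rho> * t powr (- \<rho>)) + q\<^sup>2 * (2 * k * (B t / t powr (2 * \<rho>)) - (A t / t powr \<rho>)\<^sup>2)
        = variance (Q t) / t powr (2 * \<rho>)"
      using eventually_gt_at_top[of 0]
    proof eventually_elim
      case (elim t)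
      define x where "x = t powr \<rho>"
      have x: "x > 0" "t powr (2 * \<rho>) = x\<^sup>2" "t powr (- \<rho>) = 1 / x"
        using elim by (simp_all add: x_def sq powr_minus divide_inverse)
      show ?case
        unfolding var[OF less_imp_le[OF elim]] x x_def[symmetric]
        using x(1) by (simp add: field_simps power2_eq_square)
    qed
    ultimately show ?thesis by (rule Lim_transform_eventually)
  qed
  have cov_lim: "((\<lambda>t. covariance (Q s) (Q t)) \<longlongrightarrow> q * A s + q\<^sup>2 * (k * B s)) at_top" if s: "s > 0" for s
  proof -
    have s0: "s \<ge> 0" using s by simp
    note lims = subordinator_powr_limits[OF D f1 \<beta> s0 int, folded A_def]
    \<comment> \<open>The lower bound on H turns into \<open>A s * A (t - s)\<close> by independence
      of increments, the upper bound into the mean of D_s^\<beta> D_t^\<beta>. Both are written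
      relative to \<open>A (t - s)\<close> to match the known limits.\<close>
    have "((\<lambda>t. C s t - A s * A t) \<longlongrightarrow> 0) at_top"
    proof (rule tendsto_sandwich)
      have "((\<lambda>t. - (A s * (A t - A (t - s)))) \<longlongrightarrow> - (A s * 0)) at_top"
        by (intro tendsto_minus tendsto_mult tendsto_const lims(1))
      then show "((\<lambda>t. - (A s * (A t - A (t - s)))) \<longlongrightarrow> 0) at_top" by simp
      have "((\<lambda>t. (expectation (\<lambda>\<omega>. D s \<omega> powr \<beta> * D t \<omega> powr \<beta>) - A s * A (t - s)) - A s * (A t - A (t - s)))
          \<longlongrightarrow> 0 - A s * 0) at_top"
        by (intro tendsto_diff tendsto_mult tendsto_const lims)
      then show "((\<lambda>t. (expectation (\<lambda>\<omega>. D s \<omega> powr \<beta> * D t \<omega> powr \<beta>) - A s * A (t - s)) - A s * (A t - A (t - s)))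
          \<longlongrightarrow> 0) at_top" by simp
      show "\<forall>\<^sub>F t in at_top. - (A s * (A t - A (t - s))) \<le> C s t - A s * A t"
        using eventually_ge_at_top[of s]
      proof eventually_elim
        case (elim t)
        have "A s * A (t - s) = expectation (\<lambda>\<omega>. D s \<omega> powr \<beta> * (D t \<omega> - D s \<omega>) powr \<beta>)"
          using subordinator_powr_increment(2)[OF D \<beta>(1) s0 elim int] by (simp add: A_def)
        also have "\<dots> \<le> C s t"
          unfolding C_def
          by (rule integral_mono_AE[OF powr_int(2)[OF s0 elim] H_int[OF s0 elim]],
              use D_le[OF s0 elim] in eventually_elim) (simp add: H_ge)
        finally show ?case by (simp add: algebra_simps)
      qed
      show "\<forall>\<^sub>F t in at_top. C s t - A s * A t
          \<le> (expectation (\<lambda>\<omega>. D s \<omega> powr \<beta> * D t \<omega> powr \<beta>) - A s * A (t - s)) - A s * (A t - A (t - s))"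
        using eventually_ge_at_top[of s]
      proof eventually_elim
        case (elim t)
        have "C s t \<le> expectation (\<lambda>\<omega>. D s \<omega> powr \<beta> * D t \<omega> powr \<beta>)"
          unfolding C_def
          by (rule integral_mono_AE[OF H_int[OF s0 elim] powr_int(1)[OF s0 elim]],
              use D_le[OF s0 elim] in eventually_elim) (simp add: H_le)
        then show ?case by (simp add: algebra_simps)
      qed
    qed
    then have "((\<lambda>t. q * A s + q\<^sup>2 * (k * B s + (C s t - A s * A t))) \<longlongrightarrow> q * A s + q\<^sup>2 * (k * B s + 0)) at_top"
      by (intro tendsto_add tendsto_mult tendsto_const)
    then have "((\<lambda>t. q * A s + q\<^sup>2 * (k * B s + (C s t - A s * A t))) \<longlongrightarrow> q * A s + q\<^sup>2 * (k * B s)) at_top"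
      by simp
    moreover have "\<forall>\<^sub>F t in at_top. q * A s + q\<^sup>2 * (k * B s + (C s t - A s * A t)) = covariance (Q s) (Q t)"
      using eventually_ge_at_top[of s] by eventually_elim (simp add: cov s0)
    ultimately show ?thesis by (rule Lim_transform_eventually)
  qed
  \<comment> \<open>Covariance limit over the standard deviation of \<open>Q s\<close> times the
    limit of the standard deviation of \<open>Q t\<close> divided by t^\<rho>; the exponent d is
    \<rho> for every s.\<close>
  define c where "c s = (q * A s + q\<^sup>2 * (k * B s)) / (sqrt (variance (Q s)) * sqrt c0)" for s
  have "c s > 0 \<and> ((\<lambda>t. correlation (Q s) (Q t) / t powr (- \<rho>)) \<longlongrightarrow> c s) at_top" if s: "s > 0" for s
  proof
    have "0 < q * A s" "0 \<le> q\<^sup>2 * (k * B s)"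
      using q A_pos[OF s] k B_nonneg[of s] by simp_all
    then show "c s > 0"
      using var_pos[OF s] c0 by (simp add: c_def add_pos_nonneg)
    have "((\<lambda>t. covariance (Q s) (Q t) / (sqrt (variance (Q s)) * sqrt (variance (Q t) / t powr (2 * \<rho>)))) \<longlongrightarrow> c s) at_top"
      unfolding c_def
      using var_pos[OF s] c0
      by (intro tendsto_divide tendsto_mult tendsto_const tendsto_real_sqrt cov_lim[OF s] var_lim) auto
    moreover have "\<forall>\<^sub>F t in at_top. covariance (Q s) (Q t) / (sqrt (variance (Q s)) * sqrt (variance (Q t) / t powr (2 * \<rho>)))
        = correlation (Q s) (Q t) / t powr (- \<rho>)"
      using eventually_gt_at_top[of 0]
    proof eventually_elim
      case (elim t)
      have "t powr (2 * \<rho>) = (t powr \<rho>)\<^sup>2" by (simp add: sq)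
      then have "sqrt (variance (Q t) / t powr (2 * \<rho>)) = sqrt (variance (Q t)) / t powr \<rho>"
        by (simp add: real_sqrt_divide)
      then show ?case
        by (simp add: correlation_def powr_minus divide_inverse mult_ac)
    qed
    ultimately show "((\<lambda>t. correlation (Q s) (Q t) / t powr (- \<rho>)) \<longlongrightarrow> c s) at_top"
      by (rule Lim_transform_eventually)
  qed
  moreover have "(\<lambda>t \<omega>. X (D t \<omega>) \<omega>) = Q" by (simp add: Q_def fun_eq_iff)
  ultimately show ?thesis
    unfolding long_range_dependent_def using \<open>0 < \<rho>\<close> \<open>\<rho> < 1\<close> by auto
qed

end
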